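(* Let $0<U^-<U^+$, $\nu<0$ and $x \notin\{0,1\}$ be real numbers, and let $(E_b)_{b\geqslant 1}$ be the unique solution of the infinite lower-triangular linear system $$ \sum_{\ell = 1}^b (-1)^\ell \binom{b}{\ell} \, Q_{b,\ell} \, E_{\ell} = K_b, \qquad b \geqslant 1, $$ with $Q_{b,\ell}$ and $K_b$ as defined in the context. Then the generating function $\mathfrak{G}_E(z) = \sum_{b \geqslant 1} E_b z^b$ is given, for small enough $z$, by $$ \mathfrak{G}_E(z) = \frac{x-1}{x} \left [ \frac{1-\nu}{U^- - z} + \frac{\nu}{U^- - (1-x)z} \right ] \int_0^{U^-} G \left (\zeta; \frac{z}{U^-} \right ) \, \frac{\mathrm{d}\zeta}{(1-\zeta)^2} $$ with kernel $G$ defined, for small enough $z$, by $$ G(\zeta;z) = \mathbf{\Sigma} \left[ g ( \zeta; z ) \right ] + \mathbf{\Sigma}\left[ (1-\zeta) \, g ( \zeta; z ) \right ]^2 \left ( 1 - 2\nu - \nu(1-\nu)\, \mathbf{\Sigma}\left[ (1-\zeta) \, g ( \zeta; z ) \right ] \right ), $$ where $g(\zeta;z) = x \, \mathfrak{R}(\zeta) \, \Xi(z)$.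
   Context: $\Gamma$ is the Euler Gamma function. For $1 \leqslant \ell \leqslant b$, $$ Q_{b,\ell} = - \frac{\Gamma(b)\Gamma(1-b\nu)}{\Gamma(b-b\nu)} \, (U^-)^{\ell+1} \, \frac{x^{1-b}}{1-x} \; F(\ell - b,-b \nu;-b;x), $$ where $F$ is the Gauss hypergeometric function, here the polynomial $F(\ell-b,-b\nu;-b;x) = \sum_{m=0}^{b-\ell} \frac{(\ell-b)_m(-b\nu)_m}{(-b)_m \, m!} x^m$ with $(c)_0=1$, $(c)_m = c(c+1)\cdots(c+m-1)$. The function $\mathfrak{R}$ is $$ \mathfrak{R}(\zeta) = \left ( 1 - \frac{\zeta}{U^-} \right )^{-\nu}\left ( 1 - \frac{\zeta}{U^+} \right )^{\nu - 1}, \qquad 0 \leqslant \zeta \leqslant U^- $$ (so $\mathfrak{R}(U^-)=0$), and $$ K_b = \int_0^{U^-} \left [ (b-1)(1-\zeta)^b + 1 \right ] \, \mathfrak{R}(\zeta)^b \, \frac{\mathrm{d}\zeta}{(1-\zeta)^2}, \qquad b \geqslant 1; $$ it is assumed that the parameters are such that these integrals converge absolutely for all $b \geqslant 1$ (which is automatic if $U^-<1$). The mapping $\Xi$ is $$\Xi(z) = \frac{z}{z-1}\Bigl(\frac{1-z}{1-z(1-x)}\Bigr)^{\nu}$$ near $z=0$ (branch of the power equal to $1$ at $z=0$), and $\mathbf{\Sigma}$ is the power series $$\mathbf{\Sigma}(w) = \sum_{b \geqslant 1} \frac{\Gamma(b(1-\nu))}{\Gamma(b)\Gamma(1-b\nu)}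 \, w^b,$$ which has a positive radius of convergence. *)

theory Defs
  imports "HOL-Analysis.Analysis"
begin

(* Throughout, Um and Up stand for U^- and U^+. *)

(* The Gauss function F(-n, \<beta>; \<gamma>; x) as a polynomial.  The sum is cut off at n explicitly: for
   \<gamma> = -b the later terms of the series would be quotients with vanishing denominators. *)
definition hypergeo_poly :: "nat \<Rightarrow> real \<Rightarrow> real \<Rightarrow> real \<Rightarrow> real" where
  "hypergeo_poly n \<beta> \<gamma> x =
     (\<Sum>m=0..n. pochhammer (- real n) m * pochhammer \<beta> m / (pochhammer \<gamma> m * fact m) * x ^ m)"

(* Integer power of x, since x may be negative. *)
definition Q_coeff :: "real \<Rightarrow> real \<Rightarrow> real \<Rightarrow> nat \<Rightarrow> nat \<Rightarrow> real" where
  "Q_coeff Um \<nu> x b l =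
     - (Gamma (real b) * Gamma (1 - real b * \<nu>) / Gamma (real b - real b * \<nu>))
       * Um ^ (l + 1) * (x powi (1 - int b) / (1 - x))
       * hypergeo_poly (b - l) (- real b * \<nu>) (- real b) x"

definition R_fun :: "real \<Rightarrow> real \<Rightarrow> real \<Rightarrow> real \<Rightarrow> real" where
  "R_fun Um Up \<nu> \<zeta> = (1 - \<zeta> / Um) powr (- \<nu>) * (1 - \<zeta> / Up) powr (\<nu> - 1)"

definition K_integrand :: "real \<Rightarrow> real \<Rightarrow> real \<Rightarrow> nat \<Rightarrow> real \<Rightarrow> real" where
  "K_integrand Um Up \<nu> b \<zeta> =
     ((real b - 1) * (1 - \<zeta>) ^ b + 1) * R_fun Um Up \<nu> \<zeta> ^ b / (1 - \<zeta>)\<^sup>2"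

definition K_coeff :: "real \<Rightarrow> real \<Rightarrow> real \<Rightarrow> nat \<Rightarrow> real" where
  "K_coeff Um Up \<nu> b = integral {0..Um} (K_integrand Um Up \<nu> b)"

(* The sequence is indexed by b \<ge> 1; the value E 0 plays no role. *)
definition solves_system :: "real \<Rightarrow> real \<Rightarrow> real \<Rightarrow> real \<Rightarrow> (nat \<Rightarrow> real) \<Rightarrow> bool" where
  "solves_system Um Up \<nu> x E \<longleftrightarrow>
     (\<forall>b\<ge>1. (\<Sum>l=1..b. (-1) ^ l * real (b choose l) * Q_coeff Um \<nu> x b l * E l)
             = K_coeff Um Up \<nu> b)"

(* The principal branch of powr has the value 1 at z = 0 and is holomorphic nearby. *)
definition Xi_map :: "real \<Rightarrow> real \<Rightarrow> complex \<Rightarrow> complex" where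
  "Xi_map \<nu> x z =
     z / (z - 1) * ((1 - z) / (1 - z * (1 - of_real x))) powr of_real \<nu>"

definition Sigma_fps :: "real \<Rightarrow> complex fps" where
  "Sigma_fps \<nu> = Abs_fps (\<lambda>b. if b = 0 then 0 else
     of_real (Gamma (real b * (1 - \<nu>)) / (Gamma (real b) * Gamma (1 - real b * \<nu>))))"

definition g_fun :: "real \<Rightarrow> real \<Rightarrow> real \<Rightarrow> real \<Rightarrow> real \<Rightarrow> complex \<Rightarrow> complex" where
  "g_fun Um Up \<nu> x \<zeta> z = of_real x * of_real (R_fun Um Up \<nu> \<zeta>) * Xi_map \<nu> x z"

(* Both arguments of the series \<Sigma> lie in its disc of convergence, so that G_kernel
   is the kernel of the paper and not an arbitrary value. *)
definition G_defined :: "real \<Rightarrow> real \<Rightarrow> real \<Rightarrow> real \<Rightarrow> real \<Rightarrow> complex \<Rightarrow> bool" where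
  "G_defined Um Up \<nu> x \<zeta> z \<longleftrightarrow>
     ereal (norm (g_fun Um Up \<nu> x \<zeta> z)) < fps_conv_radius (Sigma_fps \<nu>) \<and>
     ereal (norm (of_real (1 - \<zeta>) * g_fun Um Up \<nu> x \<zeta> z)) < fps_conv_radius (Sigma_fps \<nu>)"

definition G_kernel :: "real \<Rightarrow> real \<Rightarrow> real \<Rightarrow> real \<Rightarrow> real \<Rightarrow> complex \<Rightarrow> complex" where
  "G_kernel Um Up \<nu> x \<zeta> z =
     (let g = g_fun Um Up \<nu> x \<zeta> z;
          S = eval_fps (Sigma_fps \<nu>) (of_real (1 - \<zeta>) * g)
      in eval_fps (Sigma_fps \<nu>) g
           + S\<^sup>2 * (1 - 2 * of_real \<nu> - of_real \<nu> * (1 - of_real \<nu>) * S))"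

end

theory Submission
  imports Defs "HOL-Complex_Analysis.Laurent_Convergence"
begin

text \<open>
  The system is solved by Lagrange inversion. Write s_b for the coefficients of \<Sigma>, which are the
  reciprocals of the Gamma quotients in Q, and put a_l = Um^l E_l, with generating function a(z).
  The products of the binomial coefficient b over l with the hypergeometric polynomial expand into
  the sum over m of (-b\<nu>)_m x^m / m! times the binomial coefficient b - m over l
  (choose_mult_hypergeo_poly). The factors (-b\<nu>)_m x^m / m! are the coefficients of
  (1 - x u)^(b\<nu>). Hence row b of the system says that

    the coefficient of u^b in (1 - x u)^(b\<nu>) a*(u) is (x-1)/(x Um) s_b K_b x^b,

  where a*(u) = a(-u/(1-u)) / (1-u) is the binomial transform of a (solves_system_iff). A series H
  whose diagonal coefficients, those of u^b in phi^b H, equal given numbers k_b is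
  (1 - u phi'/phi) times the sum of k_b (u/phi)^b (fps_lagrange). With phi = (1 - x u)^\<nu> this gives
  a*. The binomial transform is an involution, so it also gives a, after the substitution
  u = z/(z-1), under which u/phi becomes \<Xi>(z) and the other factors become the bracket in front of
  the integral (has_fps_expansion_scaled_gen_fps). What remains to be summed is s_b K_b v^b with
  v = x \<Xi>(z/Um).

  For that, sum and integral are exchanged (integral_G_series), so that the integrand is the sum of
  s_b ((b-1)(1-\<zeta>)^b + 1) g^b over b, that is, \<Sigma>(g) plus w \<Sigma>'(w) - \<Sigma>(w) at w = (1-\<zeta>) g. A second
  use of Lagrange inversion, for phi = (1 + u)^(1-\<nu>), parametrises \<Sigma> rationally
  (Sigma_fps_compose), which makes w \<Sigma>' - \<Sigma> the cubic polynomial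
  \<Sigma>^2 (1 - 2\<nu> - \<nu>(1-\<nu>) \<Sigma>) of \<Sigma> (Sigma_fps_deriv). This is the kernel G.

  The formal identities become identities of convergent series because s_b grows at most
  geometrically (norm_Sigma_fps_nth_le) and the integrands of K_b are bounded by the b-th power of a
  constant times one integrable function (abs_K_integrand_le).
\<close>

section \<open>Lagrange inversion for formal power series\<close>

lemma fps_mult_compose_nth:
  fixes F k W :: "'a::comm_ring_1 fps"
  assumes W: "fps_nth W 0 = 0"
  shows "fps_nth (F * (k oo W)) n = (\<Sum>j=0..n. fps_nth k j * fps_nth (F * W ^ j) n)"
proof -
  have ext: "fps_nth (k oo W) m = (\<Sum>j=0..n. fps_nth k j * fps_nth (W ^ j) m)" if "m \<le> n" for m
    unfolding fps_compose_nth using that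
    by (intro sum.mono_neutral_left) (auto simp: startsby_zero_power_prefix[OF W])
  have "fps_nth (F * (k oo W)) n =
      (\<Sum>i=0..n. \<Sum>j=0..n. fps_nth k j * (fps_nth F i * fps_nth (W ^ j) (n - i)))"
    by (simp add: fps_mult_nth ext sum_distrib_left mult_ac)
  also have "\<dots> = (\<Sum>j=0..n. fps_nth k j * fps_nth (F * W ^ j) n)"
    by (subst sum.swap) (simp add: fps_mult_nth sum_distrib_left)
  finally show ?thesis .
qed

text \<open>
  The conditions are triangular in the coefficients of D: the n-th one involves D's coefficients up
  to n, and the n-th with the nonzero factor phi(0)^n.
\<close>
lemma fps_eq_0_if_diagonal_coeffs_eq_0:
  fixes phi D :: "'a::field fps"
  assumes phi: "fps_nth phi 0 \<noteq> 0" and z: "\<And>n. fps_nth (phi ^ n * D) n = 0"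
  shows "D = 0"
proof -
  have "fps_nth D n = 0" for n
  proof (induction n rule: less_induct)
    case (less n)
    have "fps_nth (phi ^ n * D) n = (\<Sum>i=0..n. if i = 0 then fps_nth phi 0 ^ n * fps_nth D n else 0)"
      unfolding fps_mult_nth by (intro sum.cong) (auto simp: fps_nth_power_0 less)
    with z[of n] phi show ?case by simp
  qed
  thus ?thesis by (simp add: fps_eq_iff)
qed

text \<open>
  For j < n and m = n - j, the left side is the coefficient of X^m in phi^m - X phi' phi^(m-1).
  As X phi' phi^(m-1) = X (phi^m)' / m, and X d/dX multiplies the coefficient of X^m by m, the
  two terms cancel.
\<close>
lemma fps_lagrange_basis:
  fixes phi :: "'a::field_char_0 fps"
  assumes phi: "fps_nth phi 0 \<noteq> 0"
  shows "fps_nth (phi ^ n * (1 - fps_X * fps_deriv phi * inverse phi) * (fps_X * inverse phi) ^ j) n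
         = (if j = n then 1 else 0)"
proof (cases "j \<le> n")
  case False
  have "fps_nth ((phi ^ n * (1 - fps_X * fps_deriv phi * inverse phi) * inverse phi ^ j) * fps_X ^ j) n = 0"
    using False by (subst fps_X_power_mult_right_nth) auto
  with False show ?thesis by (simp add: power_mult_distrib mult_ac)
next
  case True
  define m where "m = n - j"
  have n: "n = m + j" using True by (simp add: m_def)
  have inv: "phi * inverse phi = 1" using phi by (simp add: inverse_mult_eq_1')
  have invj: "phi ^ j * inverse phi ^ j = 1" using inv by (metis power_mult_distrib power_one)
  have "phi ^ n * (1 - fps_X * fps_deriv phi * inverse phi) * (fps_X * inverse phi) ^ j
      = (phi ^ m * (1 - fps_X * fps_deriv phi * inverse phi)) * (phi ^ j * inverse phi ^ j) * fps_X ^ j"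
    by (simp add: n power_add power_mult_distrib mult_ac)
  also have "\<dots> = (phi ^ m * (1 - fps_X * fps_deriv phi * inverse phi)) * fps_X ^ j"
    by (simp add: invj)
  finally have eq: "fps_nth (phi ^ n * (1 - fps_X * fps_deriv phi * inverse phi) * (fps_X * inverse phi) ^ j) n
      = fps_nth (phi ^ m * (1 - fps_X * fps_deriv phi * inverse phi)) m"
    by (simp only: n fps_X_power_mult_right_nth) simp
  show ?thesis
  proof (cases m)
    case 0
    with eq n show ?thesis by simp
  next
    case (Suc p)
    have "phi ^ m * (1 - fps_X * fps_deriv phi * inverse phi)
        = phi ^ m - fps_X * (fps_deriv phi * phi ^ p) * (phi * inverse phi)"
      by (simp add: Suc algebra_simps)
    also have "\<dots> = phi ^ m - fps_X * (fps_deriv phi * phi ^ p)" by (simp add: inv)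
    finally have e1: "phi ^ m * (1 - fps_X * fps_deriv phi * inverse phi)
        = phi ^ m - fps_X * (fps_deriv phi * phi ^ p)" .
    have "fps_deriv (phi ^ m) = of_nat m * (fps_deriv phi * phi ^ p)"
      unfolding Suc fps_deriv_power by (simp only: fps_of_nat diff_Suc_1 mult_ac)
    hence "of_nat m * fps_nth (phi ^ m) m = fps_nth (of_nat m * (fps_deriv phi * phi ^ p)) p"
      by (metis Suc Suc_eq_plus1 fps_deriv_nth)
    also have "\<dots> = of_nat m * fps_nth (fps_deriv phi * phi ^ p) p"
      by (simp add: fps_of_nat[symmetric])
    finally have "fps_nth (phi ^ m) m = fps_nth (fps_deriv phi * phi ^ p) p"
      using Suc by (simp del: of_nat_Suc)
    with e1 eq Suc n show ?thesis by simp
  qed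
qed

text \<open>
  Lagrange inversion, recovering H from the diagonal coefficients of phi^n H. The usual statement
  evaluates at the solution y of y = w phi(y); substituting w = X / phi makes y equal to X and
  gives this form. The right-hand side has the required diagonal coefficients by the case
  k = X^j, and the diagonal coefficients determine H.
\<close>
theorem fps_lagrange:
  fixes phi H k :: "'a::field_char_0 fps"
  assumes phi: "fps_nth phi 0 \<noteq> 0"
  shows "(\<forall>n. fps_nth (phi ^ n * H) n = fps_nth k n) \<longleftrightarrow>
         H = (1 - fps_X * fps_deriv phi * inverse phi) * (k oo (fps_X * inverse phi))"
proof -
  define H0 where "H0 = (1 - fps_X * fps_deriv phi * inverse phi) * (k oo (fps_X * inverse phi))"
  have H0: "fps_nth (phi ^ n * H0) n = fps_nth k n" for n
  proof -
    have "fps_nth (phi ^ n * H0) n = (\<Sum>j=0..n. fps_nth k j * (if j = n then 1 else 0))"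
      unfolding H0_def mult.assoc[symmetric]
      by (subst fps_mult_compose_nth) (simp_all only: fps_lagrange_basis[OF phi], simp)
    thus ?thesis by (simp add: sum.delta' if_distrib cong: if_cong)
  qed
  have "H = H0" if "\<forall>n. fps_nth (phi ^ n * H) n = fps_nth k n"
  proof -
    have "H - H0 = 0"
      by (rule fps_eq_0_if_diagonal_coeffs_eq_0[OF phi]) (use that H0 in \<open>simp add: ring_distribs\<close>)
    thus ?thesis by simp
  qed
  with H0 show ?thesis unfolding H0_def[symmetric] by blast
qed

lemma fps_compose_X_inverse_eq_0:
  fixes phi k :: "'a::field_char_0 fps"
  assumes phi: "fps_nth phi 0 \<noteq> 0" and "k oo (fps_X * inverse phi) = 0"
  shows "k = 0"
  using fps_lagrange[OF phi, of 0 k] assms(2) by (simp add: fps_eq_iff)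

section \<open>The series \<Sigma>\<close>

text \<open>
  Since \<nu> is negative, all Gamma arguments are positive, and the quotient of the two whose
  arguments differ by the integer n is a rising factorial.
\<close>
lemma Sigma_fps_nth_pochhammer:
  assumes "\<nu> < 0"
  shows "fps_nth (Sigma_fps \<nu>) (Suc n) =
    of_real (pochhammer (1 - real (Suc n) * \<nu>) n / fact n)"
proof -
  have "1 - real (Suc n) * \<nu> > 0" using assms by (simp add: mult_pos_neg less_trans[of _ 0 1])
  hence "pochhammer (1 - real (Suc n) * \<nu>) n = 
     Gamma (1 - real (Suc n) * \<nu> + real n) / Gamma (1 - real (Suc n) * \<nu>)"
    by (intro pochhammer_Gamma) auto
  moreover have "1 - real (Suc n) * \<nu> + real n = real (Suc n) * (1 - \<nu>)"
    by (simp add: algebra_simps)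
  ultimately show ?thesis
    by (simp add: Sigma_fps_def Gamma_fact[symmetric] add.commute del: Gamma_fact)
qed

text \<open>
  The form in which Lagrange inversion applies to \<Sigma>, with phi = (1 + X)^(1 - \<nu>) and
  H = X / (1 + X): the b-th coefficient of \<Sigma> is the generalised binomial coefficient of
  b (1 - \<nu>) - 1 over b - 1.
\<close>
lemma Sigma_fps_nth:
  assumes "\<nu> < 0"
  shows "fps_nth (Sigma_fps \<nu>) n =
    fps_nth (fps_binomial (of_real (1 - \<nu>)) ^ n * (fps_X * inverse (1 + fps_X))) n"
proof (cases n)
  case (Suc m)
  have "fps_nth (fps_binomial (of_real (1 - \<nu>)) ^ n * (fps_X * inverse (1 + fps_X))) n
     = fps_nth (fps_X * fps_binomial (of_nat n * of_real (1 - \<nu>) + (- 1 :: complex))) n"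
    by (simp only: fps_binomial_power fps_binomial_add_mult fps_binomial_minus_one mult_ac)
  also have "\<dots> = (of_nat n * of_real (1 - \<nu>) - 1) gchoose m"
    by (simp add: Suc)
  also have "\<dots> = of_real ((real n * (1 - \<nu>) - 1) gchoose m)"
    by (simp add: gbinomial_pochhammer' pochhammer_of_real[symmetric])
  also have "real n * (1 - \<nu>) - 1 gchoose m = pochhammer (1 - real n * \<nu>) m / fact m"
    unfolding gbinomial_pochhammer' by (simp add: Suc algebra_simps)
  finally show ?thesis using Sigma_fps_nth_pochhammer[OF assms, of m] Suc by simp
qed (simp add: Sigma_fps_def)

lemma fps_binomial_deriv_mult:
  "(1 + fps_X) * fps_deriv (fps_binomial c) = fps_const c * fps_binomial (c::'a::field_char_0)"
proof -
  have "(1 + fps_X) * inverse (1 + fps_X :: 'a fps) = 1"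
    by (rule inverse_mult_eq_1') simp
  thus ?thesis by (simp add: fps_binomial_deriv fps_divide_unit)
qed

text \<open>
  Lagrange inversion parametrises \<Sigma> rationally: with w = y (1 + y)^(\<nu> - 1), it is
  \<Sigma>(w) = y / (1 + \<nu> y).
\<close>
lemma Sigma_fps_compose:
  assumes nu: "\<nu> < 0"
  defines "W \<equiv> fps_X * inverse (fps_binomial (of_real (1 - \<nu>)))"
  shows "(1 + fps_const (of_real \<nu>) * fps_X) * (Sigma_fps \<nu> oo W) = fps_X"
proof -
  define B :: "complex fps" where "B = fps_binomial (of_real (1 - \<nu>))"
  have B0: "fps_nth B 0 \<noteq> 0" by (simp add: B_def)
  have BB: "B * inverse B = 1" using B0 by (rule inverse_mult_eq_1')
  have XX: "(1 + fps_X) * inverse (1 + fps_X :: complex fps) = 1"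
    by (rule inverse_mult_eq_1') simp
  have dB: "(1 + fps_X) * fps_deriv B = fps_const (of_real (1 - \<nu>)) * B"
    unfolding B_def by (rule fps_binomial_deriv_mult)
  have "fps_X * inverse (1 + fps_X) = (1 - fps_X * fps_deriv B * inverse B) * (Sigma_fps \<nu> oo W)"
    using Sigma_fps_nth[OF nu] fps_lagrange[OF B0] unfolding W_def B_def by metis
  hence "(1 + fps_X) * inverse (1 + fps_X) * fps_X
      = ((1 + fps_X) - fps_X * ((1 + fps_X) * fps_deriv B) * inverse B) * (Sigma_fps \<nu> oo W)"
    by (metis (no_types, lifting) mult.assoc mult.commute mult.left_commute right_diff_distrib mult.right_neutral)
  also have "fps_X * ((1 + fps_X) * fps_deriv B) * inverse B = fps_X * fps_const (of_real (1 - \<nu>)) * (B * inverse B)"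
    unfolding dB by (simp add: mult_ac)
  finally have "fps_X = ((1 + fps_X) - fps_X * fps_const (of_real (1 - \<nu>))) * (Sigma_fps \<nu> oo W)"
    by (simp only: XX BB) simp
  moreover have "fps_const (1 - of_real \<nu>) = 1 - fps_const (of_real \<nu> :: complex)"
    by (simp flip: fps_const_1_eq_1 fps_const_sub)
  ultimately show ?thesis by (simp add: algebra_simps)
qed

text \<open>
  The factor (b - 1) in the integrand of K turns \<Sigma> into w \<Sigma>' - \<Sigma>. By the rational
  parametrisation this is a polynomial in \<Sigma>, which is the reason why the kernel G contains no
  derivative. The proof compares both sides after substituting W for w, where differentiating
  the functional equations of B and S makes everything rational in X.
\<close>
theorem Sigma_fps_deriv:
  assumes nu: "\<nu> < 0"
  shows "fps_X * fps_deriv (Sigma_fps \<nu>) - Sigma_fps \<nu> =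
    (Sigma_fps \<nu>)\<^sup>2 * (1 - 2 * fps_const (of_real \<nu>)
       - fps_const (of_real \<nu>) * (1 - fps_const (of_real \<nu>)) * Sigma_fps \<nu>)"
proof -
  define B :: "complex fps" where "B = fps_binomial (of_real (1 - \<nu>))"
  define W where "W = fps_X * inverse B"
  define c :: "complex fps" where "c = fps_const (of_real \<nu>)"
  define S where "S = Sigma_fps \<nu> oo W"
  define S1 where "S1 = fps_deriv (Sigma_fps \<nu>) oo W"
  have B0: "fps_nth B 0 \<noteq> 0" by (simp add: B_def)
  have BB: "B * inverse B = 1" using B0 by (rule inverse_mult_eq_1')
  have W0: "fps_nth W 0 = 0" by (simp add: W_def)
  have BW: "B * W = fps_X" using BB by (simp add: W_def mult_ac)
  have c': "fps_const (of_real (1 - \<nu>)) = 1 - c"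
    by (simp add: c_def flip: fps_const_1_eq_1 fps_const_sub)
  have dB: "(1 + fps_X) * fps_deriv B = (1 - c) * B"
    unfolding B_def c'[symmetric] by (rule fps_binomial_deriv_mult)
  have dc: "fps_deriv c = 0" by (simp add: c_def)
  have S: "(1 + c * fps_X) * S = fps_X"
    using Sigma_fps_compose[OF nu] by (simp add: S_def W_def B_def c_def)
  have dBW: "fps_deriv B * W + B * fps_deriv W = 1"
    using arg_cong[OF BW, of fps_deriv] by (simp add: algebra_simps)
  have dS: "S1 * fps_deriv W = fps_deriv S"
    unfolding S_def S1_def by (rule fps_compose_deriv[OF W0, symmetric])
  have SdS: "(1 + c * fps_X) * fps_deriv S + c * S = 1"
    using arg_cong[OF S, of fps_deriv] by (simp add: dc algebra_simps)
  have w1: "(1 + fps_X) * fps_X * fps_deriv W = (1 + c * fps_X) * W"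
    using dB BW dBW by algebra
  have s1: "(1 + c * fps_X) ^ 2 * fps_deriv S = 1"
  proof -
    have "(1 + c * fps_X) * ((1 + c * fps_X) * fps_deriv S + c * S)
        = (1 + c * fps_X) ^ 2 * fps_deriv S + c * ((1 + c * fps_X) * S)"
      by (simp add: power2_eq_square algebra_simps)
    thus ?thesis by (simp add: SdS S)
  qed
  have p1: "(1 + c * fps_X) ^ 3 * (S1 * W) = fps_X * (1 + fps_X)"
    using w1 s1 dS by algebra
  \<comment> \<open>Clearing denominators: both candidates become the same polynomial in X.\<close>
  have p2: "(1 + c * fps_X) ^ 3 * (S + S\<^sup>2 * (1 - 2 * c - c * (1 - c) * S)) = fps_X * (1 + fps_X)"
  proof -
    have "(1 + c * fps_X) ^ 3 * (S + S\<^sup>2 * (1 - 2 * c - c * (1 - c) * S))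
        = (1 + c * fps_X) ^ 2 * ((1 + c * fps_X) * S)
          + (1 - 2 * c) * (1 + c * fps_X) * ((1 + c * fps_X) * S) ^ 2
          - c * (1 - c) * ((1 + c * fps_X) * S) ^ 3"
      by (simp add: power2_eq_square power3_eq_cube algebra_simps)
    also have "\<dots> = fps_X * (1 + fps_X)"
      unfolding S by (simp add: power2_eq_square power3_eq_cube algebra_simps)
    finally show ?thesis .
  qed
  have nz: "(1 + c * fps_X) ^ 3 \<noteq> 0"
  proof -
    have "fps_nth ((1 + c * fps_X) ^ 3) 0 = 1" by (simp add: fps_nth_power_0)
    thus ?thesis by force
  qed
  from p1 p2 nz have main: "S1 * W = S + S\<^sup>2 * (1 - 2 * c - c * (1 - c) * S)"
    by (metis mult_cancel_left)
  have cW: "c oo W = c" by (simp add: c_def)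
  have nW: "2 oo W = (2 :: complex fps)" by (metis fps_const_compose numeral_fps_const)
  have "(fps_X * fps_deriv (Sigma_fps \<nu>) - Sigma_fps \<nu> -
    (Sigma_fps \<nu>)\<^sup>2 * (1 - 2 * c - c * (1 - c) * Sigma_fps \<nu>)) oo W
    = W * S1 - S - S\<^sup>2 * (1 - 2 * c - c * (1 - c) * S)"
    by (simp add: fps_compose_sub_distrib fps_compose_mult_distrib[OF W0] W0 cW nW power2_eq_square
        flip: S_def S1_def)
  also have "\<dots> = 0" using main by (simp add: mult_ac)
  finally have "fps_X * fps_deriv (Sigma_fps \<nu>) - Sigma_fps \<nu> -
    (Sigma_fps \<nu>)\<^sup>2 * (1 - 2 * c - c * (1 - c) * Sigma_fps \<nu>) = 0"
    using fps_compose_X_inverse_eq_0[OF B0] unfolding W_def by blast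
  thus ?thesis unfolding c_def by simp
qed

text \<open>
  Each of the n - 1 factors of the rising factorial is at most t = n (1 - \<nu>), and
  t^(n-1) / (n-1)! is a single term of the series of exp t.
\<close>
lemma norm_Sigma_fps_nth_le:
  assumes nu: "\<nu> < 0"
  shows "norm (fps_nth (Sigma_fps \<nu>) n) \<le> exp (1 - \<nu>) ^ n"
proof (cases n)
  case (Suc m)
  have t: "real n * (1 - \<nu>) \<ge> 0" using nu by simp
  have pos: "1 - real n * \<nu> > 0" using nu by (simp add: mult_nonneg_nonpos le_less_trans[of _ 0 1])
  have "pochhammer (1 - real n * \<nu>) m \<le> (real n * (1 - \<nu>)) ^ m"
  proof -
    have "pochhammer (1 - real n * \<nu>) m \<le> (\<Prod>i=0..<m. real n * (1 - \<nu>))"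
      unfolding pochhammer_prod
    proof (intro prod_mono conjI)
      fix i assume "i \<in> {0..<m}"
      hence "real i + 1 \<le> real n" using Suc by simp
      thus "1 - real n * \<nu> + real i \<le> real n * (1 - \<nu>)" by (simp add: algebra_simps)
    qed (use pos in simp)
    thus ?thesis by simp
  qed
  hence "pochhammer (1 - real n * \<nu>) m / fact m \<le> (real n * (1 - \<nu>)) ^ m / fact m"
    by (simp add: divide_right_mono)
  also have "\<dots> \<le> exp (real n * (1 - \<nu>))"
  proof -
    have "(\<lambda>i. (real n * (1 - \<nu>)) ^ i / fact i) sums exp (real n * (1 - \<nu>))"
      using exp_converges[of "real n * (1 - \<nu>)"] by (simp add: field_simps)
    thus ?thesis
      using sum_le_suminf[of "\<lambda>i. (real n * (1 - \<nu>)) ^ i / fact i" "{m}"] t by (simp add: sums_iff)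
  qed
  also have "\<dots> = exp (1 - \<nu>) ^ n" by (simp add: exp_of_nat_mult)
  finally show ?thesis
    using Sigma_fps_nth_pochhammer[OF nu, of m] pochhammer_pos[OF pos, of m] Suc by (simp add: norm_divide)
qed (simp add: Sigma_fps_def)

lemma fps_conv_radius_Sigma_ge:
  assumes nu: "\<nu> < 0"
  shows "ereal (1 / (2 * exp (1 - \<nu>))) \<le> fps_conv_radius (Sigma_fps \<nu>)"
proof -
  define r where "r = exp (1 - \<nu>)"
  have "summable (\<lambda>n. fps_nth (Sigma_fps \<nu>) n * of_real (1 / (2 * r)) ^ n)"
  proof (rule summable_comparison_test')
    show "summable (\<lambda>n. (1 / 2 :: real) ^ n)" by (simp add: summable_geometric)
    fix n
    have "norm (fps_nth (Sigma_fps \<nu>) n) * (1 / (2 * r)) ^ n \<le> r ^ n * (1 / (2 * r)) ^ n"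
      using norm_Sigma_fps_nth_le[OF nu, of n] by (intro mult_right_mono) (auto simp: r_def)
    also have "\<dots> = (1 / 2) ^ n" by (simp add: r_def flip: power_mult_distrib)
    finally show "norm (fps_nth (Sigma_fps \<nu>) n * of_real (1 / (2 * r)) ^ n) \<le> (1 / 2) ^ n"
      by (simp add: norm_mult norm_power norm_divide r_def)
  qed
  from conv_radius_geI[OF this] show ?thesis
    by (simp add: fps_conv_radius_def r_def norm_mult norm_divide)
qed

section \<open>The triangular system as a coefficient extraction\<close>

fun forward_substitution :: "(nat \<Rightarrow> nat \<Rightarrow> 'a::field) \<Rightarrow> (nat \<Rightarrow> 'a) \<Rightarrow> nat \<Rightarrow> 'a" where
  "forward_substitution M K b =
     (if b = 0 then 0 else (K b - (\<Sum>l\<in>{1..<b}. M b l * forward_substitution M K l)) / M b b)"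

declare forward_substitution.simps [simp del]

lemma triangular_system_iff:
  fixes M :: "nat \<Rightarrow> nat \<Rightarrow> 'a::field"
  assumes M: "\<And>b. b \<ge> 1 \<Longrightarrow> M b b \<noteq> 0"
  shows "(\<forall>b\<ge>1. (\<Sum>l=1..b. M b l * E l) = K b) \<longleftrightarrow> (\<forall>b\<ge>1. E b = forward_substitution M K b)"
proof -
  have row: "(\<Sum>l=1..b. M b l * E l) = K b \<longleftrightarrow>
      E b = (K b - (\<Sum>l\<in>{1..<b}. M b l * E l)) / M b b" if "b \<ge> 1" for b
  proof -
    have "{1..b} = insert b {1..<b}" using that by auto
    hence "(\<Sum>l=1..b. M b l * E l) = M b b * E b + (\<Sum>l\<in>{1..<b}. M b l * E l)" by simp
    thus ?thesis using M[OF that] by (auto simp: field_simps)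
  qed
  show ?thesis
  proof (intro iffI allI impI)
    fix b :: nat
    assume sys: "\<forall>b\<ge>1. (\<Sum>l=1..b. M b l * E l) = K b"
    show "b \<ge> 1 \<Longrightarrow> E b = forward_substitution M K b"
    proof (induction b rule: less_induct)
      case (less b)
      have "E b = (K b - (\<Sum>l\<in>{1..<b}. M b l * E l)) / M b b" using row sys less.prems by blast
      also have "(\<Sum>l\<in>{1..<b}. M b l * E l) = (\<Sum>l\<in>{1..<b}. M b l * forward_substitution M K l)"
        using less.IH by (intro sum.cong) auto
      finally show ?case using less.prems by (subst forward_substitution.simps) simp
    qed
  next
    fix b :: nat
    assume E: "\<forall>b\<ge>1. E b = forward_substitution M K b" and b: "b \<ge> 1"
    have "E b = (K b - (\<Sum>l\<in>{1..<b}. M b l * forward_substitution M K l)) / M b b"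
      using E b forward_substitution.simps[of M K b] by simp
    also have "(\<Sum>l\<in>{1..<b}. M b l * forward_substitution M K l) = (\<Sum>l\<in>{1..<b}. M b l * E l)"
      using E by (intro sum.cong) auto
    finally show "(\<Sum>l=1..b. M b l * E l) = K b" using row[OF b] by blast
  qed
qed

text \<open>
  The generating-function form a(u) \<mapsto> a(-u/(1-u)) / (1-u) of the signed binomial transform of
  coefficients. The substitution u = z/(z-1) is an involution, so the transform can be undone by
  applying it again; it accounts for the factor z/(z-1) of \<Xi>.
\<close>
definition binomial_transform :: "'a::field fps \<Rightarrow> 'a fps" where
  "binomial_transform a = inverse (1 - fps_X) * (a oo - (fps_X * inverse (1 - fps_X)))"

lemma fps_nth_binomial_transform:
  fixes a :: "'a::field_char_0 fps"
  shows "fps_nth (binomial_transform a) n = (\<Sum>l=0..n. (-1) ^ l * of_nat (n choose l) * fps_nth a l)"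
proof -
  have "fps_nth (inverse (1 - fps_X) * (- (fps_X * inverse (1 - fps_X))) ^ j) n
      = (-1) ^ j * (of_nat (n choose j) :: 'a)" if "j \<le> n" for j
  proof -
    have "inverse (1 - fps_X) * (- (fps_X * inverse (1 - fps_X))) ^ j
        = fps_const ((-1) ^ j) * (inverse ((1 - fps_X :: 'a fps) ^ Suc j) * fps_X ^ j)"
      by (cases "even j") (simp_all add: power_mult_distrib fps_inverse_power fps_inverse_mult mult_ac
          flip: fps_const_neg)
    also have "inverse ((1 - fps_X :: 'a fps) ^ Suc j) = Abs_fps (\<lambda>k. of_nat ((Suc j + k - 1) choose k))"
      using one_minus_const_fps_X_neg_power'[of "Suc j" "1::'a"] by simp
    finally show ?thesis using that
      by (simp add: fps_X_power_mult_right_nth binomial_symmetric[of j n])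
  qed
  thus ?thesis unfolding binomial_transform_def
    by (subst fps_mult_compose_nth) (auto intro!: sum.cong)
qed

lemma binomial_transform_involution:
  fixes a :: "'a::field_char_0 fps"
  shows "binomial_transform (binomial_transform a) = a"
proof -
  define p :: "'a fps" where "p = - (fps_X * inverse (1 - fps_X))"
  have p0: "fps_nth p 0 = 0" by (simp add: p_def)
  have u: "(1 - fps_X) * inverse (1 - fps_X :: 'a fps) = 1" by (rule inverse_mult_eq_1') simp
  have "(1 - fps_X) * (1 - p) = 1" 
    using u by (simp add: p_def algebra_simps)
  hence ip: "inverse (1 - p) = 1 - fps_X" 
    by (metis fps_inverse_unique inverse_mult_eq_1 mult.commute)
  have c1: "(inverse (1 - fps_X) oo p) = 1 - fps_X"
    using p0 ip by (simp add: fps_inverse_compose fps_compose_sub_distrib)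
  have pp: "p oo p = fps_X"
  proof -
    have "p oo p = - (p * (1 - fps_X))" 
      by (subst (1) p_def) (simp add: fps_compose_uminus fps_compose_mult_distrib[OF p0] c1 p0)
    also have "\<dots> = fps_X * ((1 - fps_X) * inverse (1 - fps_X))" by (simp add: p_def mult_ac)
    finally show ?thesis by (simp add: u)
  qed
  have "binomial_transform (binomial_transform a) = inverse (1 - fps_X) * (1 - fps_X) * (a oo p oo p)"
    by (simp add: binomial_transform_def p_def[symmetric] fps_compose_mult_distrib[OF p0] c1)
  also have "a oo p oo p = a" using p0 by (simp add: fps_compose_assoc[symmetric] pp)
  finally show ?thesis using u by (simp add: mult_ac)
qed

text \<open>
  The quotient of (l-b)_m by (-b)_m turns the binomial coefficient b over l into b - m over l. So
  l enters through plain binomial coefficients only, and summing over l first produces the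
  binomial transform of the unknowns.
\<close>
lemma choose_mult_hypergeo_poly:
  assumes l: "l \<le> b"
  shows "real (b choose l) * hypergeo_poly (b - l) \<beta> (- real b) x =
    (\<Sum>m=0..b. real ((b - m) choose l) * (pochhammer \<beta> m / fact m * x ^ m))"
proof -
  have poch: "pochhammer (- real n) m = (-1) ^ m * fact m * real (n choose m)" for n m
    by (simp add: binomial_gbinomial gbinomial_pochhammer)
  have "real (b choose l) * (pochhammer (- real (b - l)) m * pochhammer \<beta> m / (pochhammer (- real b) m * fact m) * x ^ m)
     = real ((b - m) choose l) * (pochhammer \<beta> m / fact m * x ^ m)" if m: "m \<le> b - l" for m
  proof -
    have "(b choose l) * ((b - l) choose m) = (b choose m) * ((b - m) choose l)"
    proof -
      have "(b choose (l + m)) * ((l + m) choose l) = (b choose l) * ((b - l) choose m)"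
        using choose_mult[of l "l + m" b] m l by simp
      moreover have "(b choose (l + m)) * ((l + m) choose m) = (b choose m) * ((b - m) choose l)"
        using choose_mult[of m "l + m" b] m l by simp
      moreover have "(l + m) choose l = (l + m) choose m"
        using binomial_symmetric[of l "l + m"] by simp
      ultimately show ?thesis by simp
    qed
    hence "real (b choose l) * real ((b - l) choose m) = real (b choose m) * real ((b - m) choose l)"
      by (metis of_nat_mult)
    moreover have "real (b choose m) \<noteq> 0" using m l by simp
    ultimately show ?thesis using m unfolding poch by (simp add: field_simps)
  qed
  hence "real (b choose l) * hypergeo_poly (b - l) \<beta> (- real b) x =
    (\<Sum>m=0..b - l. real ((b - m) choose l) * (pochhammer \<beta> m / fact m * x ^ m))"
    unfolding hypergeo_poly_def sum_distrib_left by (intro sum.cong) auto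
  also have "\<dots> = (\<Sum>m=0..b. real ((b - m) choose l) * (pochhammer \<beta> m / fact m * x ^ m))"
    by (intro sum.mono_neutral_left) (auto simp: binomial_eq_0)
  finally show ?thesis .
qed

text \<open>
  The binomial series of (1 - x u)^\<nu> in u. The coefficients of its b-th power are the weights
  (-b\<nu>)_m x^m / m! in the hypergeometric polynomials of row b.
\<close>
definition phi_fps :: "real \<Rightarrow> real \<Rightarrow> complex fps" where
  "phi_fps \<nu> x = fps_binomial (of_real \<nu>) oo (fps_const (- of_real x) * fps_X)"

lemma phi_fps_0 [simp]: "fps_nth (phi_fps \<nu> x) 0 = 1"
  by (simp add: phi_fps_def)

lemma fps_nth_phi_fps_power:
  "fps_nth (phi_fps \<nu> x ^ b) m = of_real (pochhammer (- real b * \<nu>) m / fact m * x ^ m)"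
proof -
  have "phi_fps \<nu> x ^ b = fps_binomial (of_nat b * of_real \<nu>) oo (fps_const (- of_real x) * fps_X)"
    unfolding phi_fps_def by (subst fps_compose_power) (simp_all add: fps_binomial_power)
  hence "fps_nth (phi_fps \<nu> x ^ b) m = (- of_real x) ^ m * ((of_nat b * of_real \<nu>) gchoose m)"
    by (simp only: fps_compose_linear) simp
  also have "\<dots> = of_real (pochhammer (- real b * \<nu>) m / fact m * x ^ m)"
    by (simp add: gbinomial_pochhammer power_minus[of "of_real x"] pochhammer_of_real[symmetric])
  finally show ?thesis .
qed

text \<open>
  The power Um^l comes from the entries of the matrix; absorbing it rescales the variable by Um. The
  constant coefficient is set to 0 because the system starts at l = 1.
\<close>
definition scaled_gen_fps :: "real \<Rightarrow> (nat \<Rightarrow> real) \<Rightarrow> complex fps" where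
  "scaled_gen_fps Um E = Abs_fps (\<lambda>l. if l = 0 then 0 else of_real (Um ^ l * E l))"

text \<open>
  The right-hand sides of the system after each row has been divided by the factor that its
  entries share. The Gamma quotient in that factor is the reciprocal of the coefficient of
  \<Sigma>, which is how \<Sigma> enters the solution.
\<close>
definition rhs_fps :: "real \<Rightarrow> real \<Rightarrow> real \<Rightarrow> real \<Rightarrow> complex fps" where
  "rhs_fps Um Up \<nu> x = Abs_fps (\<lambda>b. of_real ((x - 1) / (x * Um)) *
     (fps_nth (Sigma_fps \<nu>) b * of_real (K_coeff Um Up \<nu> b)) * of_real x ^ b)"

lemma phi_fps_mult_binomial_transform_nth:
  "fps_nth (phi_fps \<nu> x ^ b * binomial_transform (scaled_gen_fps Um E)) b =
   of_real (\<Sum>l=1..b. (-1) ^ l * (real (b choose l) * hypergeo_poly (b - l) (- real b * \<nu>) (- real b) x) * (Um ^ l * E l))"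
proof -
  define P where "P m = pochhammer (- real b * \<nu>) m / fact m * x ^ m" for m
  have Pm: "fps_nth (phi_fps \<nu> x ^ b) m = of_real (P m)" for m
    unfolding P_def by (rule fps_nth_phi_fps_power)
  define e where "e l = (if l = 0 then 0 else Um ^ l * E l)" for l
  have T: "fps_nth (binomial_transform (scaled_gen_fps Um E)) (b - m)
     = of_real (\<Sum>l=0..b. (-1) ^ l * real ((b - m) choose l) * e l)" if "m \<le> b" for m
  proof -
    have "fps_nth (binomial_transform (scaled_gen_fps Um E)) (b - m)
     = (\<Sum>l=0..b - m. of_real ((-1) ^ l * real ((b - m) choose l) * e l))"
      unfolding fps_nth_binomial_transform by (intro sum.cong) (auto simp: scaled_gen_fps_def e_def)
    also have "\<dots> = (\<Sum>l=0..b. of_real ((-1) ^ l * real ((b - m) choose l) * e l))"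
      by (intro sum.mono_neutral_left) (auto simp: binomial_eq_0)
    finally show ?thesis by simp
  qed
  have "fps_nth (phi_fps \<nu> x ^ b * binomial_transform (scaled_gen_fps Um E)) b
    = of_real (\<Sum>m=0..b. \<Sum>l=0..b. (-1) ^ l * (real ((b - m) choose l) * P m) * e l)"
    unfolding fps_mult_nth of_real_sum[of _ "{0..b}"] 
    by (intro sum.cong) (simp_all add: T Pm sum_distrib_left mult_ac)
  also have "(\<Sum>m=0..b. \<Sum>l=0..b. (-1) ^ l * (real ((b - m) choose l) * P m) * e l)
    = (\<Sum>l=0..b. (-1) ^ l * (\<Sum>m=0..b. real ((b - m) choose l) * P m) * e l)"
    by (subst sum.swap) (simp add: sum_distrib_left sum_distrib_right)
  also have "\<dots> = (\<Sum>l=0..b. (-1) ^ l * (real (b choose l) * hypergeo_poly (b - l) (- real b * \<nu>) (- real b) x) * e l)"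
    unfolding P_def by (intro sum.cong) (simp_all add: choose_mult_hypergeo_poly)
  also have "\<dots> = (\<Sum>l=1..b. (-1) ^ l * (real (b choose l) * hypergeo_poly (b - l) (- real b * \<nu>) (- real b) x) * e l)"
    by (intro sum.mono_neutral_right) (auto simp: e_def not_less_eq_eq)
  also have "\<dots> = (\<Sum>l=1..b. (-1) ^ l * (real (b choose l) * hypergeo_poly (b - l) (- real b * \<nu>) (- real b) x) * (Um ^ l * E l))"
    by (intro sum.cong) (auto simp: e_def)
  finally show ?thesis .
qed

lemma Gamma_args_pos:
  assumes "\<nu> < 0" "b \<ge> 1"
  shows "Gamma (real b) > 0" "Gamma (1 - real b * \<nu>) > 0" "Gamma (real b - real b * \<nu>) > 0"
  using assms by (auto intro!: Gamma_real_pos simp: mult_nonneg_nonpos add_pos_nonneg mult_pos_neg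
     less_trans[of "real b * \<nu>" 0])

text \<open>
  After dividing out the common factor, row b states that the coefficient of u^b in (1 - x u)^(b\<nu>)
  times the transformed unknown is prescribed. This is the situation of Lagrange inversion.
\<close>
lemma solves_system_iff:
  assumes Um: "Um > 0" and nu: "\<nu> < 0" and x: "x \<noteq> 0" "x \<noteq> 1"
  shows "solves_system Um Up \<nu> x E \<longleftrightarrow>
    (\<forall>n. fps_nth (phi_fps \<nu> x ^ n * binomial_transform (scaled_gen_fps Um E)) n = fps_nth (rhs_fps Um Up \<nu> x) n)"
proof -
  have row: "(\<Sum>l=1..b. (-1) ^ l * real (b choose l) * Q_coeff Um \<nu> x b l * E l) = K_coeff Um Up \<nu> b \<longleftrightarrow>
     fps_nth (phi_fps \<nu> x ^ b * binomial_transform (scaled_gen_fps Um E)) b = fps_nth (rhs_fps Um Up \<nu> x) b"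
    if b: "b \<ge> 1" for b
  proof -
    define s where "s = Gamma (real b - real b * \<nu>) / (Gamma (real b) * Gamma (1 - real b * \<nu>))"
    have s: "s > 0" using Gamma_args_pos[OF nu b] by (simp add: s_def)
    have sig: "fps_nth (Sigma_fps \<nu>) b = of_real s" using b by (simp add: Sigma_fps_def s_def right_diff_distrib)
    define R where "R = (\<Sum>l=1..b. (-1) ^ l * (real (b choose l) * hypergeo_poly (b - l) (- real b * \<nu>) (- real b) x) * (Um ^ l * E l))"
    have xp: "x powi (1 - int b) = x / x ^ b" using x by (simp add: power_int_diff)
    have "(\<Sum>l=1..b. (-1) ^ l * real (b choose l) * Q_coeff Um \<nu> x b l * E l) = 
       - (1 / s * (x / x ^ b / (1 - x)) * Um) * R"
      unfolding R_def sum_distrib_left Q_coeff_def xp s_def by (intro sum.cong refl) (simp add: field_simps)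
    also have "\<dots> = K_coeff Um Up \<nu> b \<longleftrightarrow> R = (x - 1) / (x * Um) * (s * K_coeff Um Up \<nu> b) * x ^ b"
      using s x Um by (auto simp: field_simps)
    also have "\<dots> \<longleftrightarrow> complex_of_real R = of_real ((x - 1) / (x * Um) * (s * K_coeff Um Up \<nu> b) * x ^ b)"
      by (rule of_real_eq_iff[symmetric])
    also have "\<dots> \<longleftrightarrow> of_real R = fps_nth (rhs_fps Um Up \<nu> x) b"
      by (simp add: rhs_fps_def sig)
    finally show ?thesis unfolding phi_fps_mult_binomial_transform_nth R_def .
  qed
  have zero: "fps_nth (phi_fps \<nu> x ^ 0 * binomial_transform (scaled_gen_fps Um E)) 0 = fps_nth (rhs_fps Um Up \<nu> x) 0"
    by (simp add: fps_nth_binomial_transform scaled_gen_fps_def rhs_fps_def Sigma_fps_def)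
  show ?thesis
  proof (unfold solves_system_def, intro iffI allI impI)
    fix n :: nat
    assume "\<forall>b\<ge>1. (\<Sum>l=1..b. (-1) ^ l * real (b choose l) * Q_coeff Um \<nu> x b l * E l) = K_coeff Um Up \<nu> b"
    thus "fps_nth (phi_fps \<nu> x ^ n * binomial_transform (scaled_gen_fps Um E)) n = fps_nth (rhs_fps Um Up \<nu> x) n"
      using row zero by (cases "n = 0") auto
  qed (use row in auto)
qed

lemma solves_system_imp_fps_eq:
  assumes "Um > 0" "\<nu> < 0" "x \<noteq> 0" "x \<noteq> 1" "solves_system Um Up \<nu> x E"
  shows "scaled_gen_fps Um E = binomial_transform
     ((1 - fps_X * fps_deriv (phi_fps \<nu> x) * inverse (phi_fps \<nu> x)) *
      (rhs_fps Um Up \<nu> x oo (fps_X * inverse (phi_fps \<nu> x))))"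
  using assms solves_system_iff[of Um \<nu> x Up E] fps_lagrange[of "phi_fps \<nu> x"]
  by (metis binomial_transform_involution phi_fps_0 one_neq_zero)

text \<open>
  The matrix is lower triangular and its diagonal entries are nonzero, since the polynomial F has
  degree 0 there and equals 1.
\<close>
lemma solves_system_ex1:
  assumes Um: "Um > 0" and nu: "\<nu> < 0" and x: "x \<noteq> 0" "x \<noteq> 1"
  shows "\<exists>!E. E 0 = 0 \<and> solves_system Um Up \<nu> x E"
proof -
  define M where "M b l = (-1) ^ l * real (b choose l) * Q_coeff Um \<nu> x b l" for b l
  have "M b b \<noteq> 0" if "b \<ge> 1" for b
    using Gamma_args_pos[OF nu that] Um x by (simp add: M_def Q_coeff_def hypergeo_poly_def power_int_eq_0_iff)
  note tri = triangular_system_iff[of M, OF this]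
  have iff: "E 0 = 0 \<and> solves_system Um Up \<nu> x E \<longleftrightarrow> E = forward_substitution M (K_coeff Um Up \<nu>)" for E
  proof -
    have "E 0 = 0 \<and> solves_system Um Up \<nu> x E \<longleftrightarrow>
        E 0 = 0 \<and> (\<forall>b\<ge>1. E b = forward_substitution M (K_coeff Um Up \<nu>) b)"
      unfolding solves_system_def using tri[of E "K_coeff Um Up \<nu>"] by (simp add: M_def)
    also have "\<dots> \<longleftrightarrow> (\<forall>b. E b = forward_substitution M (K_coeff Um Up \<nu>) b)"
      by (metis forward_substitution.simps less_one linorder_not_less)
    finally show ?thesis by (simp add: fun_eq_iff)
  qed
  show ?thesis unfolding iff by simp
qed

section \<open>Expanding the integral of the kernel\<close>

lemma R_fun_nonneg: "0 \<le> R_fun Um Up \<nu> \<zeta>"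
  by (simp add: R_fun_def)

lemma R_fun_le:
  assumes "0 < Um" "Um < Up" "\<nu> < 0" "\<zeta> \<in> {0..Um}"
  shows "R_fun Um Up \<nu> \<zeta> \<le> (1 - Um / Up) powr (\<nu> - 1)"
proof -
  have "(1 - \<zeta> / Um) powr (- \<nu>) \<le> 1"
    using assms by (intro powr_le1) (auto simp: field_simps)
  moreover have "(1 - \<zeta> / Up) powr (\<nu> - 1) \<le> (1 - Um / Up) powr (\<nu> - 1)"
    using assms by (intro powr_mono2') (auto simp: field_simps)
  ultimately show ?thesis unfolding R_fun_def
    using mult_mono[of _ 1] by fastforce
qed

text \<open>
  Twice a common bound of R and |1 - \<zeta>| R on the interval of integration. The factor 2 pays for
  the linear factor b in the integrand, through b < 2^b.
\<close>
definition K_growth :: "real \<Rightarrow> real \<Rightarrow> real \<Rightarrow> real" where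
  "K_growth Um Up \<nu> = 2 * ((1 + Um) * (1 - Um / Up) powr (\<nu> - 1))"

lemma K_growth_bounds:
  assumes "0 < Um" "Um < Up" "\<nu> < 0"
  shows "K_growth Um Up \<nu> \<ge> 2" 
    and "\<zeta> \<in> {0..Um} \<Longrightarrow> 2 * R_fun Um Up \<nu> \<zeta> \<le> K_growth Um Up \<nu>"
    and "\<zeta> \<in> {0..Um} \<Longrightarrow> 2 * (\<bar>1 - \<zeta>\<bar> * R_fun Um Up \<nu> \<zeta>) \<le> K_growth Um Up \<nu>"
proof -
  define r where "r = (1 - Um / Up) powr (\<nu> - 1)"
  have "(1::real) powr (\<nu> - 1) \<le> r" unfolding r_def
    using assms by (intro powr_mono2') (auto simp: field_simps)
  hence r: "r \<ge> 1" by simp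
  have "1 * 1 \<le> (1 + Um) * r" using assms r by (intro mult_mono) auto
  thus "K_growth Um Up \<nu> \<ge> 2" by (simp add: K_growth_def r_def)
  assume z: "\<zeta> \<in> {0..Um}"
  have R: "R_fun Um Up \<nu> \<zeta> \<le> r" using R_fun_le[OF assms z] by (simp add: r_def)
  have "\<bar>1 - \<zeta>\<bar> * R_fun Um Up \<nu> \<zeta> \<le> (1 + Um) * r"
    using z assms R R_fun_nonneg by (intro mult_mono) auto
  thus "2 * (\<bar>1 - \<zeta>\<bar> * R_fun Um Up \<nu> \<zeta>) \<le> K_growth Um Up \<nu>"
    by (simp add: K_growth_def r_def)
  have "1 * R_fun Um Up \<nu> \<zeta> \<le> (1 + Um) * r"
    using assms R R_fun_nonneg by (intro mult_mono) auto
  thus "2 * R_fun Um Up \<nu> \<zeta> \<le> K_growth Um Up \<nu>"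
    by (simp add: K_growth_def r_def)
qed

lemma K_integrand_1_nonneg: "0 \<le> K_integrand Um Up \<nu> 1 \<zeta>"
  by (simp add: K_integrand_def R_fun_nonneg)

text \<open>
  One integrable majorant for all b, up to a geometric factor: the summand with (1 - \<zeta>)^b is
  bounded when b is at least 2, because the singular denominator cancels, and in the other
  summand R^(b-1) is bounded and leaves the integrand for b = 1. In the first summand the case
  b = 1 vanishes through its factor b - 1.
\<close>
lemma abs_K_integrand_le:
  assumes par: "0 < Um" "Um < Up" "\<nu> < 0" and z: "\<zeta> \<in> {0..Um}" and b: "b \<ge> 1"
  shows "\<bar>K_integrand Um Up \<nu> b \<zeta>\<bar> \<le> K_growth Um Up \<nu> ^ b * (1 + K_integrand Um Up \<nu> 1 \<zeta>)"
proof (cases "\<zeta> = 1")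
  case True
  thus ?thesis using K_growth_bounds(1)[OF par] by (simp add: K_integrand_def)
next
  case False
  define R where "R = R_fun Um Up \<nu> \<zeta>"
  define L where "L = K_growth Um Up \<nu> / 2"
  define k where "k = K_integrand Um Up \<nu> 1 \<zeta>"
  have R0: "R \<ge> 0" by (simp add: R_def R_fun_nonneg)
  have L1: "L \<ge> 1" and RL: "R \<le> L" and RL': "\<bar>1 - \<zeta>\<bar> * R \<le> L"
    using K_growth_bounds(1)[OF par] K_growth_bounds(2,3)[OF par z] by (simp_all add: L_def R_def)
  have k0: "k \<ge> 0" unfolding k_def by (rule K_integrand_1_nonneg)
  have k: "k = R / (1 - \<zeta>)\<^sup>2" by (simp add: k_def K_integrand_def R_def)
  have 1: "\<bar>(real b - 1) * (1 - \<zeta>) ^ b * R ^ b / (1 - \<zeta>)\<^sup>2\<bar> \<le> (real b - 1) * L ^ b"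
  proof (cases "b = 1")
    case False
    then obtain c where c: "b = c + 2" using b by (metis add.commute add_2_eq_Suc le_neq_implies_less less_eqE plus_1_eq_Suc Suc_leI add_Suc)
    have "(1 - \<zeta>) ^ b * R ^ b / (1 - \<zeta>)\<^sup>2 = ((1 - \<zeta>) * R) ^ c * R ^ 2"
      using \<open>\<zeta> \<noteq> 1\<close> unfolding c power_add power_mult_distrib by simp
    hence "\<bar>(1 - \<zeta>) ^ b * R ^ b / (1 - \<zeta>)\<^sup>2\<bar> = (\<bar>1 - \<zeta>\<bar> * R) ^ c * R ^ 2"
      using R0 by (simp only: abs_mult power_abs abs_of_nonneg abs_power2)
    also have "\<dots> \<le> L ^ c * L ^ 2"
      using R0 RL RL' by (intro mult_mono power_mono) auto
    also have "L ^ c * L ^ 2 = L ^ b" by (simp only: c power_add)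
    finally have "\<bar>(1 - \<zeta>) ^ b * R ^ b / (1 - \<zeta>)\<^sup>2\<bar> \<le> L ^ b" .
    hence "(real b - 1) * \<bar>(1 - \<zeta>) ^ b * R ^ b / (1 - \<zeta>)\<^sup>2\<bar> \<le> (real b - 1) * L ^ b"
      using b by (intro mult_left_mono) auto
    thus ?thesis using b by (simp add: abs_mult mult.assoc)
  qed simp
  have 2: "\<bar>R ^ b / (1 - \<zeta>)\<^sup>2\<bar> \<le> L ^ b * k"
  proof -
    obtain c where c: "b = Suc c" using b by (cases b) auto
    have "\<bar>R ^ b / (1 - \<zeta>)\<^sup>2\<bar> = R ^ c * k" using R0 by (simp add: c k)
    also have "\<dots> \<le> L ^ b * k"
    proof (rule mult_right_mono[OF _ k0])
      have "R ^ c \<le> L ^ c" using R0 RL by (intro power_mono) auto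
      also have "\<dots> \<le> L ^ b" using L1 by (intro power_increasing) (auto simp: c)
      finally show "R ^ c \<le> L ^ b" .
    qed
    finally show ?thesis .
  qed
  have "K_integrand Um Up \<nu> b \<zeta> = (real b - 1) * (1 - \<zeta>) ^ b * R ^ b / (1 - \<zeta>)\<^sup>2 + R ^ b / (1 - \<zeta>)\<^sup>2"
    by (simp add: K_integrand_def R_def add_divide_distrib ring_distribs)
  hence "\<bar>K_integrand Um Up \<nu> b \<zeta>\<bar> \<le> (real b - 1) * L ^ b + L ^ b * k"
    by (simp only:) (rule order_trans[OF abs_triangle_ineq add_mono[OF 1 2]])
  also have "\<dots> \<le> real b * L ^ b + real b * (L ^ b * k)"
  proof (rule add_mono)
    show "(real b - 1) * L ^ b \<le> real b * L ^ b" using L1 by (intro mult_right_mono) auto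
    have "1 * (L ^ b * k) \<le> real b * (L ^ b * k)" using b L1 k0 by (intro mult_right_mono) auto
    thus "L ^ b * k \<le> real b * (L ^ b * k)" by simp
  qed
  also have "\<dots> = real b * (L ^ b * (1 + k))" by (simp add: algebra_simps)
  also have "\<dots> \<le> 2 ^ b * (L ^ b * (1 + k))"
    using of_nat_less_two_power[of b, where 'a = real] L1 k0 by (intro mult_right_mono) auto
  also have "\<dots> = (2 * L) ^ b * (1 + k)" by (simp add: power_mult_distrib)
  finally show ?thesis by (simp add: L_def k_def)
qed

text \<open>
  The kernel as a function of v = x \<Xi>, through which alone it depends on z.
\<close>
definition G_series :: "real \<Rightarrow> real \<Rightarrow> real \<Rightarrow> real \<Rightarrow> complex \<Rightarrow> complex" where
  "G_series Um Up \<nu> \<zeta> v =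
     (let g = of_real (R_fun Um Up \<nu> \<zeta>) * v;
          S = eval_fps (Sigma_fps \<nu>) (of_real (1 - \<zeta>) * g)
      in eval_fps (Sigma_fps \<nu>) g
           + S\<^sup>2 * (1 - 2 * of_real \<nu> - of_real \<nu> * (1 - of_real \<nu>) * S))"

lemma sums_Sigma_shifted:
  assumes nu: "\<nu> < 0" and w: "ereal (norm w) < fps_conv_radius (Sigma_fps \<nu>)"
  defines "S \<equiv> eval_fps (Sigma_fps \<nu>) w"
  shows "(\<lambda>b. (of_nat b - 1) * fps_nth (Sigma_fps \<nu>) b * w ^ b) sums
           (S\<^sup>2 * (1 - 2 * of_real \<nu> - of_real \<nu> * (1 - of_real \<nu>) * S))"
proof -
  have S0: "fps_nth (Sigma_fps \<nu>) 0 = 0" by (simp add: Sigma_fps_def)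
  define F1 where "F1 = Sigma_fps \<nu> * Sigma_fps \<nu>"
  define F2 where "F2 = fps_const (of_real \<nu> * (1 - of_real \<nu>)) * Sigma_fps \<nu>"
  define F3 where "F3 = fps_const (1 - 2 * of_real \<nu>) - F2"
  have 1: "ereal (norm w) < fps_conv_radius F1"
    unfolding F1_def using w fps_conv_radius_mult[of "Sigma_fps \<nu>" "Sigma_fps \<nu>"]
    by (auto intro: less_le_trans)
  have 2: "ereal (norm w) < fps_conv_radius F2"
    unfolding F2_def using w fps_conv_radius_mult[of "fps_const (of_real \<nu> * (1 - of_real \<nu>))" "Sigma_fps \<nu>"]
    by (auto intro: less_le_trans)
  have 3: "ereal (norm w) < fps_conv_radius F3"
    unfolding F3_def using 2 fps_conv_radius_diff[of "fps_const (1 - 2 * of_real \<nu>)" F2]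
    by (auto intro: less_le_trans)
  have 4: "ereal (norm w) < fps_conv_radius (F1 * F3)"
    using 1 3 by (intro less_le_trans[OF _ fps_conv_radius_mult]) simp
  have F: "F1 * F3 = fps_X * fps_deriv (Sigma_fps \<nu>) - Sigma_fps \<nu>"
    unfolding Sigma_fps_deriv[OF nu] F1_def F2_def F3_def
    by (simp add: power2_eq_square numeral_fps_const flip: fps_const_sub fps_const_mult)
  have nth: "fps_nth (F1 * F3) b = (of_nat b - 1) * fps_nth (Sigma_fps \<nu>) b" for b
    unfolding F by (cases b) (simp_all add: S0 algebra_simps)
  have "eval_fps (F1 * F3) w = S * S * (1 - 2 * of_real \<nu> - of_real \<nu> * (1 - of_real \<nu>) * S)"
    using w 1 2 3 by (simp add: eval_fps_mult eval_fps_diff F1_def F2_def F3_def S_def)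
  with sums_eval_fps[OF 4] show ?thesis by (simp add: nth power2_eq_square)
qed

text \<open>
  The two parts of the kernel are \<Sigma>(g) and w \<Sigma>'(w) - \<Sigma>(w) at w = (1 - \<zeta>) g. Their
  b-th coefficients carry the weights 1 and (b - 1) (1 - \<zeta>)^b, which add up to the bracket in
  the integrand of K.
\<close>
lemma sums_G_series:
  assumes nu: "\<nu> < 0"
    and g: "ereal (norm (of_real (R_fun Um Up \<nu> \<zeta>) * v)) < fps_conv_radius (Sigma_fps \<nu>)"
    and g': "ereal (norm (of_real (1 - \<zeta>) * (of_real (R_fun Um Up \<nu> \<zeta>) * v))) < fps_conv_radius (Sigma_fps \<nu>)"
  shows "(\<lambda>b. of_real (K_integrand Um Up \<nu> b \<zeta>) * (fps_nth (Sigma_fps \<nu>) b * v ^ b)) sums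
           (G_series Um Up \<nu> \<zeta> v / of_real ((1 - \<zeta>)\<^sup>2))"
proof -
  define g where "g = of_real (R_fun Um Up \<nu> \<zeta>) * v"
  have "(\<lambda>b. fps_nth (Sigma_fps \<nu>) b * g ^ b +
      (of_nat b - 1) * fps_nth (Sigma_fps \<nu>) b * (of_real (1 - \<zeta>) * g) ^ b) sums G_series Um Up \<nu> \<zeta> v"
    unfolding G_series_def g_def[symmetric] Let_def
    using assms by (intro sums_add sums_eval_fps sums_Sigma_shifted) (simp_all add: g_def)
  from sums_divide[OF this, of "of_real ((1 - \<zeta>)\<^sup>2)"]
  have sums: "(\<lambda>b. (fps_nth (Sigma_fps \<nu>) b * g ^ b +
      (of_nat b - 1) * fps_nth (Sigma_fps \<nu>) b * (of_real (1 - \<zeta>) * g) ^ b) / of_real ((1 - \<zeta>)\<^sup>2))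
      sums (G_series Um Up \<nu> \<zeta> v / of_real ((1 - \<zeta>)\<^sup>2))" .
  have "(fps_nth (Sigma_fps \<nu>) b * g ^ b +
      (of_nat b - 1) * fps_nth (Sigma_fps \<nu>) b * (of_real (1 - \<zeta>) * g) ^ b) / of_real ((1 - \<zeta>)\<^sup>2)
    = of_real (K_integrand Um Up \<nu> b \<zeta>) * (fps_nth (Sigma_fps \<nu>) b * v ^ b)" for b
  proof -
    define y where "y = complex_of_real (1 - \<zeta>)"
    define r where "r = complex_of_real (R_fun Um Up \<nu> \<zeta>)"
    have K: "of_real (K_integrand Um Up \<nu> b \<zeta>) = ((of_nat b - 1) * y ^ b + 1) * r ^ b / y\<^sup>2"
      unfolding K_integrand_def y_def r_def by simp
    have y2: "complex_of_real ((1 - \<zeta>)\<^sup>2) = y\<^sup>2" by (simp add: y_def)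
    show ?thesis unfolding K y2 g_def y_def[symmetric] r_def[symmetric] power_mult_distrib
      by (simp add: algebra_simps add_divide_distrib diff_divide_distrib)
  qed
  with sums show ?thesis by simp
qed

text \<open>
  Chosen such that, for |v| up to this radius, the b-th term of the expanded kernel is at most
  2^(-b) times an integrable function.
\<close>
definition kernel_radius :: "real \<Rightarrow> real \<Rightarrow> real \<Rightarrow> real" where
  "kernel_radius Um Up \<nu> = 1 / (2 * exp (1 - \<nu>) * K_growth Um Up \<nu>)"

lemma kernel_radius_pos:
  assumes par: "0 < Um" "Um < Up" "\<nu> < 0"
  shows "kernel_radius Um Up \<nu> > 0"
  using K_growth_bounds(1)[OF par] by (simp add: kernel_radius_def)

lemma kernel_radius_imp_in_disc:
  fixes v :: complex
  assumes par: "0 < Um" "Um < Up" "\<nu> < 0" and z: "\<zeta> \<in> {0..Um}" 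
    and v: "norm v \<le> kernel_radius Um Up \<nu>"
  shows "ereal (norm (of_real (R_fun Um Up \<nu> \<zeta>) * v)) < fps_conv_radius (Sigma_fps \<nu>)"
    and "ereal (norm (of_real (1 - \<zeta>) * (of_real (R_fun Um Up \<nu> \<zeta>) * v))) < fps_conv_radius (Sigma_fps \<nu>)"
proof -
  note L = K_growth_bounds(1)[OF par] K_growth_bounds(2,3)[OF par z]
  have key: "ereal (c * norm v) < fps_conv_radius (Sigma_fps \<nu>)" 
    if c: "0 \<le> c" "2 * c \<le> K_growth Um Up \<nu>" for c
  proof -
    \<comment> \<open>The factor 2 in the growth bound gives the strict inequality.\<close>
    have "c * norm v \<le> (K_growth Um Up \<nu> / 2) * kernel_radius Um Up \<nu>"
      using c v L(1) by (intro mult_mono) auto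
    also have "\<dots> < 1 / (2 * exp (1 - \<nu>))" using L(1) by (simp add: kernel_radius_def field_simps)
    finally have "ereal (c * norm v) < ereal (1 / (2 * exp (1 - \<nu>)))" by simp
    with fps_conv_radius_Sigma_ge[OF par(3)] show ?thesis by (rule less_le_trans[rotated])
  qed
  show "ereal (norm (of_real (R_fun Um Up \<nu> \<zeta>) * v)) < fps_conv_radius (Sigma_fps \<nu>)"
    using key[OF R_fun_nonneg L(2)] by (simp add: norm_mult R_fun_nonneg)
  have "norm (of_real (1 - \<zeta>) * (of_real (R_fun Um Up \<nu> \<zeta>) * v)) = \<bar>1 - \<zeta>\<bar> * R_fun Um Up \<nu> \<zeta> * norm v"
    by (simp only: norm_mult norm_of_real) (simp add: R_fun_nonneg)
  thus "ereal (norm (of_real (1 - \<zeta>) * (of_real (R_fun Um Up \<nu> \<zeta>) * v))) < fps_conv_radius (Sigma_fps \<nu>)"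
    using key[OF _ L(3)] by (simp add: R_fun_nonneg)
qed

text \<open>
  Summation and integration are exchanged by dominated convergence, with the geometric majorant
  from the bound on the integrands.
\<close>
lemma integral_G_series:
  assumes par: "0 < Um" "Um < Up" "\<nu> < 0"
    and K_conv: "\<forall>b\<ge>1. K_integrand Um Up \<nu> b absolutely_integrable_on {0..Um}"
    and v: "norm v \<le> kernel_radius Um Up \<nu>"
  shows "(\<lambda>\<zeta>. G_series Um Up \<nu> \<zeta> v / of_real ((1 - \<zeta>)\<^sup>2)) absolutely_integrable_on {0..Um}"
    and "(\<lambda>b. fps_nth (Sigma_fps \<nu>) b * of_real (K_coeff Um Up \<nu> b) * v ^ b) sums
           integral {0..Um} (\<lambda>\<zeta>. G_series Um Up \<nu> \<zeta> v / of_real ((1 - \<zeta>)\<^sup>2))"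
proof -
  define G where "G = (\<lambda>\<zeta>. G_series Um Up \<nu> \<zeta> v / of_real ((1 - \<zeta>)\<^sup>2))"
  define f where "f b \<zeta> = of_real (indicator {0..Um} \<zeta> *\<^sub>R K_integrand Um Up \<nu> b \<zeta>) * (fps_nth (Sigma_fps \<nu>) b * v ^ b)" for b \<zeta>
  define h where "h \<zeta> = indicator {0..Um} \<zeta> *\<^sub>R (1 + K_integrand Um Up \<nu> 1 \<zeta>)" for \<zeta>
  have S0: "fps_nth (Sigma_fps \<nu>) 0 = 0" by (simp add: Sigma_fps_def)
  have f0: "f 0 = (\<lambda>_. 0)" by (intro ext) (simp add: f_def S0)
  have fint: "integrable lebesgue (f b)" for b
  proof (cases "b = 0")
    case False
    with K_conv have "integrable lebesgue (\<lambda>\<zeta>. indicator {0..Um} \<zeta> *\<^sub>R K_integrand Um Up \<nu> b \<zeta>)"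
      by (simp add: set_integrable_def)
    thus ?thesis unfolding f_def by (intro integrable_mult_left integrable_of_real) auto
  next
    case True
    with f0 show ?thesis by simp
  qed
  have hint: "integrable lebesgue h"
  proof -
    have "set_integrable lebesgue {0..Um} (\<lambda>\<zeta>. 1 + K_integrand Um Up \<nu> 1 \<zeta>)"
      using K_conv by (intro set_integral_add(1)) auto
    thus ?thesis unfolding set_integrable_def h_def[abs_def] .
  qed
  have L: "K_growth Um Up \<nu> \<ge> 2" by (rule K_growth_bounds(1)[OF par])
  have bound: "norm (f b \<zeta>) \<le> (1 / 2) ^ b * h \<zeta>" for b \<zeta>
  proof (cases "\<zeta> \<in> {0..Um} \<and> b \<noteq> 0")
    case True
    define k where "k = 1 + K_integrand Um Up \<nu> 1 \<zeta>"
    have k: "k \<ge> 0" unfolding k_def using K_integrand_1_nonneg[of Um Up \<nu> \<zeta>] by simp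
    have "norm (f b \<zeta>) = \<bar>K_integrand Um Up \<nu> b \<zeta>\<bar> * (norm (fps_nth (Sigma_fps \<nu>) b) * norm v ^ b)"
      using True by (simp add: f_def norm_mult norm_power)
    also have "\<dots> \<le> (K_growth Um Up \<nu> ^ b * k) * (exp (1 - \<nu>) ^ b * kernel_radius Um Up \<nu> ^ b)"
      using True v k L norm_Sigma_fps_nth_le[OF par(3), of b] unfolding k_def
      by (intro mult_mono power_mono abs_K_integrand_le[OF par]) auto
    also have "\<dots> = (K_growth Um Up \<nu> * exp (1 - \<nu>) * kernel_radius Um Up \<nu>) ^ b * k"
      by (simp add: power_mult_distrib mult_ac)
    also have "K_growth Um Up \<nu> * exp (1 - \<nu>) * kernel_radius Um Up \<nu> = 1 / 2"
      using L by (simp add: kernel_radius_def)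
    finally show ?thesis using True by (simp add: h_def k_def)
  next
    case False
    moreover have "h \<zeta> \<ge> 0" using K_integrand_1_nonneg[of Um Up \<nu> \<zeta>] by (simp add: h_def)
    ultimately show ?thesis by (auto simp: f_def S0)
  qed
  have summ: "summable (\<lambda>b. norm (f b \<zeta>))" for \<zeta>
    by (rule summable_comparison_test'[where g = "\<lambda>b. (1 / 2) ^ b * h \<zeta>" and N = 0])
       (use bound in \<open>auto intro!: summable_mult2 summable_geometric\<close>)
  have summ_int: "summable (\<lambda>b. LINT \<zeta>|lebesgue. norm (f b \<zeta>))"
  proof (rule summable_comparison_test'[where g = "\<lambda>b. (1 / 2) ^ b * integral\<^sup>L lebesgue h" and N = 0])
    show "summable (\<lambda>b. (1 / 2) ^ b * integral\<^sup>L lebesgue h)"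
      by (intro summable_mult2 summable_geometric) simp
    fix b
    have "(LINT \<zeta>|lebesgue. norm (f b \<zeta>)) \<le> (LINT \<zeta>|lebesgue. (1 / 2) ^ b * h \<zeta>)"
      using fint hint bound by (intro integral_mono) auto
    thus "norm (LINT \<zeta>|lebesgue. norm (f b \<zeta>)) \<le> (1 / 2) ^ b * integral\<^sup>L lebesgue h"
      by simp
  qed
  have suminf: "(\<Sum>b. f b \<zeta>) = indicator {0..Um} \<zeta> *\<^sub>R G \<zeta>" for \<zeta>
  proof (cases "\<zeta> \<in> {0..Um}")
    case True
    have "(\<lambda>b. f b \<zeta>) sums G \<zeta>"
      using sums_G_series[OF par(3) kernel_radius_imp_in_disc[OF par True v]] True by (simp add: f_def G_def)
    thus ?thesis using True by (simp add: sums_iff)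
  qed (simp add: f_def)
  have "integrable lebesgue (\<lambda>\<zeta>. indicator {0..Um} \<zeta> *\<^sub>R G \<zeta>)"
    using integrable_suminf[OF fint _ summ_int] summ by (simp add: suminf)
  thus G_int: "G absolutely_integrable_on {0..Um}" by (simp add: set_integrable_def)
  have "(\<lambda>b. integral\<^sup>L lebesgue (f b)) sums (LINT \<zeta>|lebesgue. indicator {0..Um} \<zeta> *\<^sub>R G \<zeta>)"
    using sums_integral[OF fint _ summ_int] summ by (simp add: suminf)
  also have "(LINT \<zeta>|lebesgue. indicator {0..Um} \<zeta> *\<^sub>R G \<zeta>) = integral {0..Um} G"
    using set_lebesgue_integral_eq_integral(2)[OF G_int] by (simp add: set_lebesgue_integral_def)
  also have "(\<lambda>b. integral\<^sup>L lebesgue (f b)) =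
      (\<lambda>b. fps_nth (Sigma_fps \<nu>) b * of_real (K_coeff Um Up \<nu> b) * v ^ b)"
  proof
    fix b
    show "integral\<^sup>L lebesgue (f b) = fps_nth (Sigma_fps \<nu>) b * of_real (K_coeff Um Up \<nu> b) * v ^ b"
    proof (cases "b = 0")
      case False
      hence *: "(LINT \<zeta>|lebesgue. indicator {0..Um} \<zeta> *\<^sub>R K_integrand Um Up \<nu> b \<zeta>) = K_coeff Um Up \<nu> b"
        using K_conv set_lebesgue_integral_eq_integral(2)[of "{0..Um}" "K_integrand Um Up \<nu> b"]
        by (simp add: K_coeff_def set_lebesgue_integral_def)
      have "integral\<^sup>L lebesgue (f b) = of_real (K_coeff Um Up \<nu> b) * (fps_nth (Sigma_fps \<nu>) b * v ^ b)"
        unfolding f_def integral_mult_left_zero integral_complex_of_real * ..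
      thus ?thesis by simp
    qed (simp add: f0 S0)
  qed
  finally show "(\<lambda>b. fps_nth (Sigma_fps \<nu>) b * of_real (K_coeff Um Up \<nu> b) * v ^ b) sums integral {0..Um} G" .
qed

section \<open>From formal to convergent series\<close>

lemma has_fps_expansion_cong_eventually:
  fixes f g :: "'a::{banach,real_normed_div_algebra} \<Rightarrow> 'a"
  assumes "f has_fps_expansion F" "eventually (\<lambda>z. f z = g z) (nhds 0)"
  shows "g has_fps_expansion F"
proof -
  have "eventually (\<lambda>z. eval_fps F z = f z) (nhds 0)"
    using assms(1) by (simp add: has_fps_expansion_def)
  with assms(2) have "eventually (\<lambda>z. eval_fps F z = g z) (nhds 0)"
    by eventually_elim simp
  with assms(1) show ?thesis by (simp add: has_fps_expansion_def)
qed

lemma has_fps_expansion_binomial_transform: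
  fixes f :: "complex \<Rightarrow> complex"
  assumes "f has_fps_expansion F"
  shows "(\<lambda>y. f (y / (y - 1)) / (1 - y)) has_fps_expansion binomial_transform F"
proof -
  have "(\<lambda>y. inverse (1 - y) * (f \<circ> (\<lambda>y. - (y * inverse (1 - y)))) y) has_fps_expansion binomial_transform F"
    unfolding binomial_transform_def
    by (intro has_fps_expansion_mult has_fps_expansion_compose[OF assms] has_fps_expansion_minus
        has_fps_expansion_inverse has_fps_expansion_diff has_fps_expansion_fps_X has_fps_expansion_1) simp_all
  moreover have "- (y * inverse (1 - y)) = y / (y - 1)" for y :: complex
    by (cases "y = 1") (auto simp: field_simps)
  ultimately show ?thesis by (simp add: field_simps o_def)
qed

lemma has_fps_expansion_phi:
  "(\<lambda>u. (1 - of_real x * u) powr of_real \<nu>) has_fps_expansion phi_fps \<nu> x"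
proof -
  have "((\<lambda>u. (1 + u) powr of_real \<nu>) \<circ> (\<lambda>u. - of_real x * u)) has_fps_expansion phi_fps \<nu> x"
    unfolding phi_fps_def
    by (intro has_fps_expansion_compose[OF has_fps_expansion_binomial_complex]
        has_fps_expansion_cmult_left has_fps_expansion_fps_X) simp
  thus ?thesis by (simp add: o_def)
qed

text \<open>
  The factor 1 - X phi'/phi of Lagrange inversion for phi = (1 - x X)^\<nu>, whose logarithmic
  derivative is rational. The binomial transform turns it into the bracket in front of the integral.
\<close>
lemma phi_fps_lagrange_factor:
  "1 - fps_X * fps_deriv (phi_fps \<nu> x) * inverse (phi_fps \<nu> x)
   = 1 + fps_const (of_real (\<nu> * x)) * fps_X * inverse (1 - fps_const (of_real x) * fps_X)"
proof -
  define q :: "complex fps" where "q = fps_const (- of_real x) * fps_X"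
  define P where "P = phi_fps \<nu> x"
  have q0: "fps_nth q 0 = 0" by (simp add: q_def)
  have P0: "fps_nth P 0 \<noteq> 0" by (simp add: P_def)
  have dq: "fps_deriv q = fps_const (- of_real x)" by (simp add: q_def)
  have "(1 + fps_X) * fps_deriv (fps_binomial (of_real \<nu>)) oo q = fps_const (of_real \<nu>) * fps_binomial (of_real \<nu>) oo q"
    by (simp only: fps_binomial_deriv_mult)
  hence "(1 + q) * (fps_deriv (fps_binomial (of_real \<nu>)) oo q) = fps_const (of_real \<nu>) * P"
    by (simp add: fps_compose_mult_distrib[OF q0] fps_compose_add_distrib q0 P_def phi_fps_def q_def[symmetric])
  hence "(1 + q) * fps_deriv P = fps_const (of_real \<nu>) * P * fps_const (- of_real x)"
    unfolding P_def phi_fps_def q_def[symmetric] fps_compose_deriv[OF q0] dq by (simp only: mult.assoc[symmetric])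
  hence dP: "(1 + q) * fps_deriv P = - fps_const (of_real (\<nu> * x)) * P"
    by (simp add: mult_ac flip: fps_const_neg)
  have Q: "1 - fps_const (of_real x) * fps_X = 1 + q" by (simp add: q_def flip: fps_const_neg)
  have inv: "(1 + q) * inverse (1 + q) = 1" "P * inverse P = 1"
    using q0 P0 by (auto intro!: inverse_mult_eq_1')
  have "fps_deriv P * inverse P = ((1 + q) * inverse (1 + q)) * (fps_deriv P * inverse P)"
    by (simp add: inv)
  also have "\<dots> = inverse (1 + q) * ((1 + q) * fps_deriv P) * inverse P" by (simp only: mult_ac)
  also have "\<dots> = - fps_const (of_real (\<nu> * x)) * inverse (1 + q) * (P * inverse P)"
    unfolding dP by (simp only: mult_ac)
  finally have "fps_deriv P * inverse P = - fps_const (of_real (\<nu> * x)) * inverse (1 + q)"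
    by (simp add: inv)
  hence "fps_X * fps_deriv P * inverse P = - (fps_const (of_real (\<nu> * x)) * fps_X * inverse (1 + q))"
    by (simp only: mult.assoc) (simp only: mult_minus_left mult_minus_right mult_ac)
  thus ?thesis unfolding Q P_def[symmetric] by simp
qed

lemma powr_inverse_Re_pos:
  fixes q c :: complex
  assumes "Re q > 0"
  shows "inverse (q powr c) = inverse q powr c"
proof -
  have "q \<notin> \<real>\<^sub>\<le>\<^sub>0" "q \<noteq> 0" using assms by (auto simp: complex_nonpos_Reals_iff)
  thus ?thesis by (simp add: powr_def Ln_inverse exp_minus)
qed

lemma tendsto_Xi_map: "(Xi_map \<nu> x \<longlongrightarrow> 0) (nhds 0)"
proof -
  have "isCont (Xi_map \<nu> x) 0"
    unfolding Xi_map_def by (intro continuous_intros) auto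
  thus ?thesis
    using tendsto_at_iff_tendsto_nhds[of "Xi_map \<nu> x" 0] by (simp add: isCont_def Xi_map_def)
qed

text \<open>
  The formal solution evaluated as a function. The outer binomial transform substitutes
  u = y/(y-1), and then u / (1 - x u)^\<nu> is exactly \<Xi>(y), because
  1 - x u = (1 - y (1 - x)) / (1 - y). Near y = 0 that quotient has positive real part, which
  makes the principal power compatible with inversion.
\<close>
lemma has_fps_expansion_scaled_gen_fps:
  assumes par: "0 < Um" "\<nu> < 0" "x \<noteq> 0" "x \<noteq> 1"
    and sys: "solves_system Um Up \<nu> x E" and k: "k has_fps_expansion rhs_fps Um Up \<nu> x"
  shows "(\<lambda>y. ((1 - of_real \<nu>) / (1 - y) + of_real \<nu> / (1 - (1 - of_real x) * y)) * k (Xi_map \<nu> x y))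
           has_fps_expansion scaled_gen_fps Um E"
proof -
  define H where "H = (\<lambda>u. (1 + of_real (\<nu> * x) * u * inverse (1 - of_real x * u)) *
      (k \<circ> (\<lambda>u. u * inverse ((1 - of_real x * u) powr of_real \<nu>))) u)"
  have "H has_fps_expansion
     (1 + fps_const (of_real (\<nu> * x)) * fps_X * inverse (1 - fps_const (of_real x) * fps_X)) *
      (rhs_fps Um Up \<nu> x oo (fps_X * inverse (phi_fps \<nu> x)))"
    unfolding H_def
    by (intro has_fps_expansion_mult has_fps_expansion_compose[OF k] has_fps_expansion_add
        has_fps_expansion_diff has_fps_expansion_inverse has_fps_expansion_cmult_left
        has_fps_expansion_fps_X has_fps_expansion_1 has_fps_expansion_phi) simp_all
  hence "(\<lambda>y. H (y / (y - 1)) / (1 - y)) has_fps_expansion scaled_gen_fps Um E"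
    unfolding solves_system_imp_fps_eq[OF par sys] phi_fps_lagrange_factor
    by (rule has_fps_expansion_binomial_transform)
  thus ?thesis
  proof (rule has_fps_expansion_cong_eventually)
    have "((\<lambda>y. Re ((1 - y * (1 - of_real x)) / (1 - y))) \<longlongrightarrow> Re ((1 - 0 * (1 - of_real x)) / (1 - 0))) (nhds (0::complex))"
      by (intro tendsto_intros filterlim_ident) auto
    hence ev1: "eventually (\<lambda>y::complex. Re ((1 - y * (1 - of_real x)) / (1 - y)) > 0) (nhds 0)"
      by (rule order_tendstoD) auto
    show "eventually (\<lambda>y. H (y / (y - 1)) / (1 - y) =
        ((1 - of_real \<nu>) / (1 - y) + of_real \<nu> / (1 - (1 - of_real x) * y)) * k (Xi_map \<nu> x y)) (nhds 0)"
      using ev1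
    proof eventually_elim
      case (elim y)
      define q where "q = (1 - y * (1 - of_real x)) / (1 - y)"
      define d where "d = 1 - y * (1 - of_real x)"
      have nz: "1 - y \<noteq> 0" "d \<noteq> 0" using elim by (auto simp: d_def)
      have nz': "y \<noteq> 1" "y - 1 \<noteq> 0" using nz(1) by auto
      have q: "1 - of_real x * (y / (y - 1)) = q"
        using nz' nz(1) by (simp add: q_def field_simps)
      have qd: "q = d / (1 - y)" by (simp add: q_def d_def)
      have Xi: "y / (y - 1) * inverse (q powr of_real \<nu>) = Xi_map \<nu> x y"
        using powr_inverse_Re_pos[of q "of_real \<nu>"] elim
        by (simp add: q_def[symmetric] Xi_map_def) (simp add: q_def)
      have pre: "(1 + of_real (\<nu> * x) * (y / (y - 1)) * inverse q) / (1 - y)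
         = (1 - of_real \<nu>) / (1 - y) + of_real \<nu> / d"
      proof -
        define e where "e = 1 - y"
        define N where "N = complex_of_real (\<nu> * x)"
        have e: "e \<noteq> 0" "y - 1 = - e" "1 - y = e" using nz by (simp_all add: e_def)
        have "(1 + N * (y / (y - 1)) * inverse q) / (1 - y) = (1 - N * y / d) / e"
          unfolding qd e(2,3) using e(1) by simp
        also have "1 - N * y / d = (d - N * y) / d" using nz(2) by (simp add: diff_divide_distrib)
        finally have "(1 + of_real (\<nu> * x) * (y / (y - 1)) * inverse q) / (1 - y)
            = (d - of_real (\<nu> * x) * y) / (d * (1 - y))"
          by (simp only: N_def e(3) divide_divide_eq_left)
        also have "d - of_real (\<nu> * x) * y = (1 - of_real \<nu>) * d + of_real \<nu> * (1 - y)"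
          by (simp add: d_def algebra_simps)
        also have "\<dots> / (d * (1 - y)) = (1 - of_real \<nu>) / (1 - y) + of_real \<nu> / d"
          using nz by (simp add: add_divide_distrib)
        finally show ?thesis .
      qed
      have "H (y / (y - 1)) / (1 - y) = (1 + of_real (\<nu> * x) * (y / (y - 1)) * inverse q) / (1 - y)
          * k (y / (y - 1) * inverse (q powr of_real \<nu>))"
        unfolding H_def o_def q by (rule times_divide_eq_left[symmetric])
      thus ?case unfolding pre Xi d_def by (simp only: mult.commute)
    qed
  qed
qed

lemma g_fun_conv_Xi_map:
  "g_fun Um Up \<nu> x \<zeta> z = of_real (R_fun Um Up \<nu> \<zeta>) * (of_real x * Xi_map \<nu> x z)"
  unfolding g_fun_def by (simp only: mult.assoc mult.left_commute)

lemma G_kernel_conv_G_series: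
  "G_kernel Um Up \<nu> x \<zeta> z = G_series Um Up \<nu> \<zeta> (of_real x * Xi_map \<nu> x z)"
  unfolding G_kernel_def G_series_def g_fun_conv_Xi_map ..

theorem corollary4p2:
  fixes Um Up \<nu> x :: real
  assumes "0 < Um" and "Um < Up" and "\<nu> < 0" and "x \<noteq> 0" and "x \<noteq> 1"
    and K_conv: "\<forall>b\<ge>1. K_integrand Um Up \<nu> b absolutely_integrable_on {0..Um}"
  shows "(\<exists>!E. E 0 = 0 \<and> solves_system Um Up \<nu> x E) \<and>
    (\<forall>E. solves_system Um Up \<nu> x E \<longrightarrow>
      (\<forall>\<^sub>F z :: complex in nhds 0.
        (\<forall>\<zeta>\<in>{0..Um}. G_defined Um Up \<nu> x \<zeta> (z / of_real Um)) \<and>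
        (\<lambda>\<zeta>. G_kernel Um Up \<nu> x \<zeta> (z / of_real Um) / of_real ((1 - \<zeta>)\<^sup>2))
          absolutely_integrable_on {0..Um} \<and>
        (\<lambda>n. of_real (E (Suc n)) * z ^ Suc n) sums
          ((of_real x - 1) / of_real x
            * ((1 - of_real \<nu>) / (of_real Um - z)
               + of_real \<nu> / (of_real Um - (1 - of_real x) * z))
            * integral {0..Um}
                (\<lambda>\<zeta>. G_kernel Um Up \<nu> x \<zeta> (z / of_real Um) / of_real ((1 - \<zeta>)\<^sup>2)))))"
proof (intro conjI allI impI)
  show "\<exists>!E. E 0 = 0 \<and> solves_system Um Up \<nu> x E"
    using assms by (intro solves_system_ex1)
next
  fix E assume sys: "solves_system Um Up \<nu> x E"
  note par = assms(1,2,3)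
  define c where "c = complex_of_real ((x - 1) / (x * Um))"
  define J where "J v = integral {0..Um} (\<lambda>\<zeta>. G_series Um Up \<nu> \<zeta> v / of_real ((1 - \<zeta>)\<^sup>2))" for v
  define k where "k w = c * J (of_real x * w)" for w
  note r0 = kernel_radius_pos[OF par]
  have small: "eventually (\<lambda>z. norm (f z) \<le> kernel_radius Um Up \<nu>) (nhds 0)" if "(f \<longlongrightarrow> 0) (nhds 0)" for f :: "complex \<Rightarrow> complex"
    using order_tendstoD(2)[OF tendsto_norm_zero[OF that] r0] by eventually_elim simp
  have k_exp: "k has_fps_expansion rhs_fps Um Up \<nu> x"
  proof (rule has_fps_expansionI)
    have "((\<lambda>w. of_real x * w) \<longlongrightarrow> of_real x * 0) (nhds (0::complex))"
      by (intro tendsto_intros filterlim_ident)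
    hence "eventually (\<lambda>w. norm (of_real x * w :: complex) \<le> kernel_radius Um Up \<nu>) (nhds 0)"
      by (intro small) simp
    thus "eventually (\<lambda>w. (\<lambda>n. fps_nth (rhs_fps Um Up \<nu> x) n * w ^ n) sums k w) (nhds 0)"
    proof eventually_elim
      case (elim w)
      from sums_mult[OF integral_G_series(2)[OF par K_conv elim], of c] show ?case
        by (simp add: rhs_fps_def k_def J_def c_def power_mult_distrib mult_ac)
    qed
  qed
  \<comment> \<open>The generating function in the rescaled variable y = z / Um.\<close>
  define A where "A y = ((1 - of_real \<nu>) / (1 - y) + of_real \<nu> / (1 - (1 - of_real x) * y)) * k (Xi_map \<nu> x y)" for y
  have A: "A has_fps_expansion scaled_gen_fps Um E"
    unfolding A_def using assms sys k_exp by (intro has_fps_expansion_scaled_gen_fps)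
  have scale: "((\<lambda>z. z / of_real Um) \<longlongrightarrow> 0) (nhds (0::complex))"
    by (rule tendsto_divide_zero[OF filterlim_ident])
  have vlim: "((\<lambda>z. of_real x * Xi_map \<nu> x (z / of_real Um)) \<longlongrightarrow> 0) (nhds 0)"
    using tendsto_mult_right_zero[OF filterlim_compose[OF tendsto_Xi_map scale]] by simp
  have ev1: "eventually (\<lambda>z. norm (of_real x * Xi_map \<nu> x (z / of_real Um)) \<le> kernel_radius Um Up \<nu>) (nhds 0)"
    by (rule small[OF vlim])
  have "eventually (\<lambda>y. (\<lambda>n. fps_nth (scaled_gen_fps Um E) n * y ^ n) sums A y) (nhds 0)"
  proof -
    have "eventually (\<lambda>y. y \<in> eball 0 (fps_conv_radius (scaled_gen_fps Um E))) (nhds 0)"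
      using A by (intro eventually_nhds_in_open) (auto simp: has_fps_expansion_def zero_ereal_def)
    moreover have "eventually (\<lambda>y. eval_fps (scaled_gen_fps Um E) y = A y) (nhds 0)"
      using A by (simp add: has_fps_expansion_def)
    ultimately show ?thesis
    proof eventually_elim
      case (elim y)
      with sums_eval_fps[of y "scaled_gen_fps Um E"] show ?case by simp
    qed
  qed
  hence ev2: "eventually (\<lambda>z. (\<lambda>n. fps_nth (scaled_gen_fps Um E) n * (z / of_real Um) ^ n) sums A (z / of_real Um)) (nhds 0)"
    by (rule eventually_compose_filterlim[OF _ scale])
  show "\<forall>\<^sub>F z :: complex in nhds 0.
        (\<forall>\<zeta>\<in>{0..Um}. G_defined Um Up \<nu> x \<zeta> (z / of_real Um)) \<and>
        (\<lambda>\<zeta>. G_kernel Um Up \<nu> x \<zeta> (z / of_real Um) / of_real ((1 - \<zeta>)\<^sup>2))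
          absolutely_integrable_on {0..Um} \<and>
        (\<lambda>n. of_real (E (Suc n)) * z ^ Suc n) sums
          ((of_real x - 1) / of_real x
            * ((1 - of_real \<nu>) / (of_real Um - z)
               + of_real \<nu> / (of_real Um - (1 - of_real x) * z))
            * integral {0..Um}
                (\<lambda>\<zeta>. G_kernel Um Up \<nu> x \<zeta> (z / of_real Um) / of_real ((1 - \<zeta>)\<^sup>2)))"
    using ev1 ev2
  proof eventually_elim
    case (elim z)
    define y where "y = z / of_real Um"
    define U where "U = complex_of_real Um"
    have U: "U \<noteq> 0" using par by (simp add: U_def)
    have z: "z = U * y" using U by (simp add: y_def U_def)
    have terms: "fps_nth (scaled_gen_fps Um E) (Suc n) * y ^ Suc n = of_real (E (Suc n)) * z ^ Suc n" for n
      by (simp add: scaled_gen_fps_def z U_def power_mult_distrib mult_ac)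
    have "(\<lambda>n. fps_nth (scaled_gen_fps Um E) n * y ^ n) sums A y" using elim(2) by (simp add: y_def)
    hence "(\<lambda>n. fps_nth (scaled_gen_fps Um E) (Suc n) * y ^ Suc n) sums A y"
      by (subst sums_Suc_iff) (simp add: scaled_gen_fps_def)
    hence sums: "(\<lambda>n. of_real (E (Suc n)) * z ^ Suc n) sums A y" by (simp only: terms)
    have den: "(1 - of_real \<nu>) / (U - z) + of_real \<nu> / (U - (1 - of_real x) * z)
        = ((1 - of_real \<nu>) / (1 - y) + of_real \<nu> / (1 - (1 - of_real x) * y)) / U"
    proof -
      have "U - z = U * (1 - y)" "U - (1 - of_real x) * z = U * (1 - (1 - of_real x) * y)"
        by (simp_all add: z algebra_simps)
      thus ?thesis using U by (simp add: add_divide_distrib mult.commute)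
    qed
    have c: "c = (of_real x - 1) / (of_real x * U)" by (simp add: c_def U_def)
    have "A y = (of_real x - 1) / of_real x * ((1 - of_real \<nu>) / (U - z) + of_real \<nu> / (U - (1 - of_real x) * z))
            * J (of_real x * Xi_map \<nu> x y)"
      unfolding den A_def k_def c
      by (simp only: times_divide_eq_left times_divide_eq_right divide_divide_eq_left mult_ac)
    with sums have "(\<lambda>n. of_real (E (Suc n)) * z ^ Suc n) sums
          ((of_real x - 1) / of_real x * ((1 - of_real \<nu>) / (U - z) + of_real \<nu> / (U - (1 - of_real x) * z))
            * J (of_real x * Xi_map \<nu> x y))" by simp
    thus ?case
      unfolding G_defined_def g_fun_conv_Xi_map G_kernel_conv_G_series J_def y_def U_def
      using kernel_radius_imp_in_disc[OF par _ elim(1)] integral_G_series(1)[OF par K_conv elim(1)]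
      by blast
  qed
qed

end
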